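(* Let $d\ge 1$ be an integer. There exists a finite constant $\gamma^{**}$ such that for every $\gamma\ge\gamma^{**}$ and every $\varepsilon\in(0,2)$ the following holds with $$r_n=\gamma\left(\frac{\log n}{n}\right)^{1/d}.$$ Let $(c_n)$ be any sequence of integers with $2\le c_n<n$. (1) If $c_n\ge\sqrt{\frac{(2+\varepsilon)\log n}{\log\log n}}$ for all sufficiently large $n$, then $\lim_{n\to\infty}\mathbf P\{S_n(r_n,c_n)\text{ is connected}\}=1$. (2) If $c_n\le\sqrt{\frac{(2-\varepsilon)\log n}{\log\log n}}$ for all sufficiently large $n$, then $\lim_{n\to\infty}\mathbf P\{S_n(r_n,c_n)\text{ is connected}\}=0$.
   Context: Let $X_1,\dots,X_n$ be independent uniformly distributed random points in $[0,1]^d$. The random geometric graph $G_n(r)$ has vertex set $\{1,\dots,n\}$, and distinct $i,j$ are joined by an edge iff $\|X_i-X_j\|<r$ (Euclidean norm). For an integer $2\le c<n$, the Bluetooth (random irrigation) graph $S_n(r,c)$ is the following random undirected spanning subgraph of $G_n(r)$. Given $G_n(r)$, every vertex $v$ independently picks, uniformly at random without replacement, $c$ of the edges of $G_n(r)$ incident to $v$ (all of them if the degree of $v$ in $G_n(r)$ is less than $c$). The edge set of $S_n(r,c)$ is the union of all picked edges. *)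

theory Defs
  imports "HOL-Probability.Probability"
begin

text \<open>Vertices are the numbers \<open>1, \<dots>, n\<close>; an undirected edge is a two-element set of vertices and
  a graph on \<open>{1..n}\<close> is given by its edge set.\<close>

definition uniform_points :: "nat \<Rightarrow> (nat \<Rightarrow> real ^ 'd) measure" where
  "uniform_points n = PiM {1..n} (\<lambda>_. uniform_measure lborel (cbox 0 1))"

definition geometric_edges :: "nat \<Rightarrow> real \<Rightarrow> (nat \<Rightarrow> real ^ 'd) \<Rightarrow> nat set set" where
  "geometric_edges n r x =
     {{i, j} | i j. i \<in> {1..n} \<and> j \<in> {1..n} \<and> i \<noteq> j \<and> norm (x i - x j) < r}"

definition incident_edges :: "nat set set \<Rightarrow> nat \<Rightarrow> nat set set" where
  "incident_edges E v = {e \<in> E. v \<in> e}"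

definition picked_edges_pmf :: "nat set set \<Rightarrow> nat \<Rightarrow> nat \<Rightarrow> nat set set pmf" where
  "picked_edges_pmf E c v =
     pmf_of_set {A. A \<subseteq> incident_edges E v \<and> card A = min c (card (incident_edges E v))}"

definition irrigation_pmf :: "nat \<Rightarrow> nat \<Rightarrow> nat set set \<Rightarrow> nat set set pmf" where
  "irrigation_pmf n c E =
     map_pmf (\<lambda>A. \<Union>v\<in>{1..n}. A v) (Pi_pmf {1..n} {} (picked_edges_pmf E c))"

text \<open>The law of the edge set of \<open>S\<^sub>n(r, c)\<close>. The type argument only fixes the dimension
  \<open>d = CARD('d)\<close>. The kernel is measurable (\<open>irrigation_kernel_measurable\<close>), so the Giry bind
  has its usual meaning; see \<open>measure_irrigation_law\<close>.\<close>

definition irrigation_law :: "'d::finite itself \<Rightarrow> nat \<Rightarrow> real \<Rightarrow> nat \<Rightarrow> nat set set measure" where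
  "irrigation_law _ n r c =
     (uniform_points n :: (nat \<Rightarrow> real ^ 'd) measure) \<bind>
       (\<lambda>x. measure_pmf (irrigation_pmf n c (geometric_edges n r x)))"

definition graph_connected :: "nat \<Rightarrow> nat set set \<Rightarrow> bool" where
  "graph_connected n E \<longleftrightarrow>
     (\<forall>u\<in>{1..n}. \<forall>v\<in>{1..n}. (u, v) \<in> {(a, b). {a, b} \<in> E}\<^sup>*)"

lemma prob_space_uniform_points:
  "prob_space (uniform_points n :: (nat \<Rightarrow> real ^ 'd) measure)"
proof -
  have one: "1 \<bullet> b = 1" if "b \<in> Basis" for b :: "real ^ 'd"
    using that by (auto simp: Basis_vec_def inner_axis)
  then have "emeasure lborel (cbox 0 (1 :: real ^ 'd)) = 1"
    using emeasure_lborel_cbox_eq[of "0 :: real ^ 'd" 1] by simp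
  then have "prob_space (uniform_measure lborel (cbox 0 (1 :: real ^ 'd)))"
    by (intro prob_space_uniform_measure) auto
  then show ?thesis
    unfolding uniform_points_def by (intro prob_space_PiM)
qed

lemma geometric_edges_measurable:
  "geometric_edges n r \<in> (uniform_points n :: (nat \<Rightarrow> real ^ 'd) measure)
     \<rightarrow>\<^sub>M count_space (Pow (Pow {1..n}))"
proof -
  let ?M = "uniform_points n :: (nat \<Rightarrow> real ^ 'd) measure"
  let ?P = "\<lambda>i j (x :: nat \<Rightarrow> real ^ 'd). norm (x i - x j) < r"
  have meas: "{x \<in> space ?M. ?P i j x} \<in> sets ?M"
    if "i \<in> {1..n}" "j \<in> {1..n}" for i j
  proof -
    have comp: "(\<lambda>x. x k) \<in> borel_measurable ?M" if "k \<in> {1..n}" for k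
      using measurable_component_singleton[OF that, of "\<lambda>_. uniform_measure lborel (cbox 0 (1 :: real ^ 'd))"]
      unfolding uniform_points_def
      by (simp cong: measurable_cong_sets)
    have "(\<lambda>x. norm (x i - x j)) \<in> borel_measurable ?M"
      by (intro measurable_compose[OF _ borel_measurable_norm] borel_measurable_diff comp that)
    then show ?thesis
      by (rule borel_measurable_less) simp
  qed
  have "geometric_edges n r -` {E} \<inter> space ?M \<in> sets ?M" if "E \<subseteq> Pow {1..n}" for E
  proof -
    have iff: "geometric_edges n r x = E \<longleftrightarrow>
       (\<forall>e\<in>Pow {1..n}. (\<exists>i\<in>{1..n}. \<exists>j\<in>{1..n}. (e = {i, j} \<and> i \<noteq> j) \<and> ?P i j x) \<longleftrightarrow> e \<in> E)"
      for x :: "nat \<Rightarrow> real ^ 'd"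
    proof -
      have mem: "e \<in> geometric_edges n r x \<longleftrightarrow>
          (\<exists>i\<in>{1..n}. \<exists>j\<in>{1..n}. (e = {i, j} \<and> i \<noteq> j) \<and> ?P i j x)" for e
        unfolding geometric_edges_def by blast
      have sub: "geometric_edges n r x \<subseteq> Pow {1..n}"
        unfolding geometric_edges_def by auto
      show ?thesis
        unfolding mem[symmetric] using sub that by blast
    qed
    have "geometric_edges n r -` {E} \<inter> space ?M = {x \<in> space ?M. geometric_edges n r x = E}"
      by auto
    also have "\<dots> \<in> sets ?M"
      unfolding iff iff_conv_conj_imp
      by (intro sets.sets_Collect_finite_All sets.sets_Collect_finite_Ex sets.sets_Collect_conj
            sets.sets_Collect_imp sets.sets_Collect_const meas) auto
    finally show ?thesis .
  qed
  then show ?thesis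
    by (subst measurable_count_space_eq2) (simp_all, auto simp: geometric_edges_def)
qed

lemma irrigation_kernel_measurable:
  "(\<lambda>x. measure_pmf (irrigation_pmf n c (geometric_edges n r x)))
     \<in> (uniform_points n :: (nat \<Rightarrow> real ^ 'd) measure) \<rightarrow>\<^sub>M subprob_algebra (count_space UNIV)"
  by (rule measurable_compose[OF geometric_edges_measurable])
     (auto simp: space_subprob_algebra measure_pmf.subprob_space_axioms)

lemma prob_space_irrigation_law: "prob_space (irrigation_law TYPE('d::finite) n r c)"
  unfolding irrigation_law_def
  by (rule prob_space.prob_space_bind[OF prob_space_uniform_points _ irrigation_kernel_measurable])
     (simp add: measure_pmf.prob_space_axioms)

lemma measure_irrigation_law:
  "measure (irrigation_law TYPE('d::finite) n r c) A =
     (\<integral>x. measure_pmf.prob (irrigation_pmf n c (geometric_edges n r x)) A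
        \<partial>(uniform_points n :: (nat \<Rightarrow> real ^ 'd) measure))"
proof -
  interpret prob_space "uniform_points n :: (nat \<Rightarrow> real ^ 'd) measure"
    by (rule prob_space_uniform_points)
  show ?thesis
    unfolding irrigation_law_def
    by (rule measure_bind[OF irrigation_kernel_measurable]) simp
qed

lemma picked_edges_pmf_support:
  assumes "finite E"
  shows "set_pmf (picked_edges_pmf E c v) =
    {A. A \<subseteq> incident_edges E v \<and> card A = min c (card (incident_edges E v))}"
proof -
  have fin: "finite (incident_edges E v)"
    using assms by (simp add: incident_edges_def)
  obtain A where "A \<subseteq> incident_edges E v" "card A = min c (card (incident_edges E v))"
    by (rule obtain_subset_with_card_n[OF min.cobounded2])
  then have "{A. A \<subseteq> incident_edges E v \<and> card A = min c (card (incident_edges E v))} \<noteq> {}"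
    by blast
  moreover have "finite {A. A \<subseteq> incident_edges E v \<and> card A = min c (card (incident_edges E v))}"
    using fin by (rule finite_subset[OF _ finite_Pow_iff[THEN iffD2], rotated]) blast
  ultimately show ?thesis
    unfolding picked_edges_pmf_def by (rule set_pmf_of_set)
qed

end

theory Submission
  imports Defs "HOL-Real_Asymp.Real_Asymp"
begin

text \<open>The threshold is governed by isolated cliques. Write \<open>L = ln n\<close>. All degrees of the geometric
  graph are of order \<open>L\<close>, so \<open>c + 1\<close> mutually adjacent vertices pick exactly each other with
  probability about \<open>(c! / L\<^sup>c)\<^bsup>c + 1\<^esup>\<close>; for \<open>c\<close> of order \<open>sqrt (L / ln L)\<close> this is
  \<open>exp (- (1 + o(1)) c\<^sup>2 ln L / 2)\<close>. Being picked by no outside vertex costs a further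
  factor \<open>exp (- O(c\<^sup>2))\<close> only, and all polylogarithmic factors are negligible. Since there are
  \<open>n\<^bsup>1 - o(1)\<^esup>\<close> essentially independent places for such a clique, cliques appear if
  \<open>c\<^sup>2 \<le> (2 - \<epsilon>) L / ln L\<close> and are absent if \<open>c\<^sup>2 \<ge> (2 + \<epsilon>) L / ln L\<close>.

  The randomness of the points enters only through one event. Cut the cube into \<open>M\<^sup>d\<close> cells of side
  between \<open>r / (3 d)\<close> and \<open>r / (2 d)\<close>; with high probability every cell contains between \<open>\<mu> / 4\<close> and \<open>4 \<mu>\<close>
  points, where \<open>\<mu> = n / M\<^sup>d\<close> is a large multiple of \<open>L\<close> (\<open>balanced_prob\<close>). Given this, the geometric
  graph is a fixed graph of the kind described by the locale \<open>boxed_graph\<close>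
  (\<open>balanced_boxed_graph\<close>), and the picks at different vertices are independent. Everything else
  is a statement about such a fixed graph.

  \<^emph>\<open>Connectivity\<close> (\<open>prob_disconnected_le\<close>). Let \<open>m \<le> c\<close> be the threshold value
  rounded up; every vertex makes at least \<open>m\<close> picks. Call a vertex set closed if no picked edge leaves
  it. A union of two touching boxes is a clique of order \<open>L\<close>; that a closed set cuts it into two parts
  of order \<open>L\<close> has probability \<open>exp (- \<Omega>(m L))\<close>, which beats the \<open>exp (O(L))\<close> possible cuts.
  Hence every closed set contains few vertices of every box, or almost all of every box, and a
  disconnected graph has a component \<open>T\<close> that contains few vertices of every box. Such a
  component has at least \<open>m + 1\<close> vertices, there are at most \<open>n (O(L))\<^bsup>2 k\<^esup>\<close> candidates of size
  \<open>k\<close> because a connected set is traced out by a walk of length less than \<open>2 k\<close>, and all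
  picks of its vertices stay inside with probability at most \<open>(min (k / \<Theta>(L)) (1 / 10))\<^bsup>m k\<^esup>\<close>. The sum over
  \<open>k\<close> is dominated by \<open>k = m + 1\<close>, which is the clique computation above
  (\<open>connectivity_bound\<close>).

  \<^emph>\<open>Disconnection\<close> (\<open>prob_connected_le\<close>). A greedy choice gives \<open>n / O(L\<^sup>2)\<close> vertices such that the
  events that a given \<open>(c + 1)\<close>-subset of their box is an isolated clique depend on disjoint sets
  of picks. These events are independent, and their probabilities are so large that at least
  \<open>n\<^bsup>\<epsilon> / 4\<^esup>\<close> of them occur on average (\<open>isolation_bound\<close>).\<close>

section \<open>Random picks at a single vertex\<close>

lemma Suc_times_binomial_Suc: "Suc k * (n choose Suc k) = (n - k) * (n choose k)"
proof (cases "k \<le> n")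
  case True
  then show ?thesis
    by (metis binomial_absorb_comp binomial_absorption)
next
  case False
  then show ?thesis by (simp add: binomial_eq_0)
qed

text \<open>In \<open>(f choose k) / (D choose k) = (\<Prod>i<k. (f - i) / (D - i))\<close> the factors decrease with \<open>i\<close>, so for
  \<open>k \<le> c \<le> f \<le> D\<close> they lie between \<open>(f - c) / (D - c)\<close> and \<open>f / D\<close>.\<close>
lemma binomial_ratio_le:
  assumes "f \<le> D"
  shows "(f choose k) * D ^ k \<le> (D choose k) * f ^ k"
proof (induction k)
  case (Suc k)
  have mono: "(f - k) * D \<le> (D - k) * f"
    using assms by (simp add: diff_mult_distrib mult.commute[of f D] diff_le_mono2)
  have "Suc k * ((f choose Suc k) * D ^ Suc k) = ((f - k) * D) * ((f choose k) * D ^ k)"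
    using Suc_times_binomial_Suc[of k f] by (simp only: power_Suc mult.assoc[symmetric]) (simp add: ac_simps)
  also have "\<dots> \<le> ((D - k) * f) * ((D choose k) * f ^ k)"
    by (intro mult_mono mono Suc.IH) auto
  also have "\<dots> = Suc k * ((D choose Suc k) * f ^ Suc k)"
    using Suc_times_binomial_Suc[of k D] by (simp only: power_Suc mult.assoc[symmetric]) (simp add: ac_simps)
  finally show ?case by (simp only: mult_le_cancel1)
qed simp

lemma binomial_ratio_ge:
  assumes "f \<le> D" "k \<le> c" "c \<le> f"
  shows "(D choose k) * (f - c) ^ k \<le> (f choose k) * (D - c) ^ k"
  using assms(2)
proof (induction k)
  case (Suc k)
  have "(D - k) * (f - c) \<le> (f - k) * (D - c)"
  proof -
    have "int (D - k) * int (f - c) \<le> int (f - k) * int (D - c)"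
    proof -
      have nonneg: "0 \<le> (int D - int f) * (int c - int k)"
        using assms(1) Suc.prems by simp
      have diffs: "int (D - k) = int D - int k" "int (f - c) = int f - int c"
          "int (f - k) = int f - int k" "int (D - c) = int D - int c"
        using assms Suc.prems by auto
      have "(int D - int k) * (int f - int c)
          \<le> (int D - int k) * (int f - int c) + (int D - int f) * (int c - int k)"
        using nonneg by (rule le_add_same_cancel1[THEN iffD2])
      also have "\<dots> = (int f - int k) * (int D - int c)" by (simp add: algebra_simps)
      finally show ?thesis unfolding diffs .
    qed
    then show ?thesis by (simp only: of_nat_mult[symmetric] of_nat_le_iff)
  qed
  note mono = this
  have "Suc k * ((D choose Suc k) * (f - c) ^ Suc k) = ((D - k) * (f - c)) * ((D choose k) * (f - c) ^ k)"
    using Suc_times_binomial_Suc[of k D] by (simp only: power_Suc mult.assoc[symmetric]) (simp add: ac_simps)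
  also have "\<dots> \<le> ((f - k) * (D - c)) * ((f choose k) * (D - c) ^ k)"
    using Suc by (intro mult_mono mono Suc.IH) auto
  also have "\<dots> = Suc k * ((f choose Suc k) * (D - c) ^ Suc k)"
    using Suc_times_binomial_Suc[of k f] by (simp only: power_Suc mult.assoc[symmetric]) (simp add: ac_simps)
  finally show ?case by (simp only: mult_le_cancel1)
qed simp

lemma one_minus_ge_exp:
  fixes x :: real
  assumes "0 \<le> x" "x \<le> 1/2"
  shows "exp (- 2 * x) \<le> 1 - x"
proof -
  have "- x - 2 * x\<^sup>2 \<le> ln (1 - x)"
    using assms by (intro ln_one_minus_pos_lower_bound) auto
  moreover have "x * x \<le> x * (1/2)" using assms by (intro mult_left_mono) auto
  ultimately have "- 2 * x \<le> ln (1 - x)" by (simp add: power2_eq_square)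
  then have "exp (- 2 * x) \<le> exp (ln (1 - x))" by simp
  also have "\<dots> = 1 - x" using assms by simp
  finally show ?thesis .
qed

lemma power_le_exp_fact: "real c ^ c \<le> exp (real c) * fact c"
proof -
  have s: "summable (\<lambda>k. inverse (fact k) * real c ^ k)" by (rule summable_exp)
  have "inverse (fact c) * real c ^ c = sum (\<lambda>k. inverse (fact k) * real c ^ k) {c}" by simp
  also have "\<dots> \<le> (\<Sum>k. inverse (fact k) * real c ^ k)"
    by (rule sum_le_suminf[OF s]) auto
  also have "\<dots> = exp (real c)" by (simp add: exp_def scaleR_conv_of_real divide_inverse)
  finally show ?thesis by (simp add: field_simps)
qed

lemma measure_picked_edges_pmf:
  fixes v :: nat
  assumes "finite E"
  defines "D \<equiv> card (incident_edges E v)"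
  shows "measure_pmf.prob (picked_edges_pmf E c v) X =
    card ({A. A \<subseteq> incident_edges E v \<and> card A = min c D} \<inter> X) / (D choose min c D)"
proof -
  have fin: "finite (incident_edges E v)"
    using assms by (simp add: incident_edges_def)
  let ?S = "{A. A \<subseteq> incident_edges E v \<and> card A = min c D}"
  have card: "card ?S = D choose min c D"
    unfolding D_def by (rule n_subsets[OF fin])
  have finS: "finite ?S" using fin by simp
  moreover have "?S \<noteq> {}" using card by (metis card.empty binomial_eq_0_iff min.cobounded2 not_le)
  ultimately show ?thesis
    unfolding picked_edges_pmf_def D_def[symmetric] by (simp add: measure_pmf_of_set card)
qed

lemma pick_subset_prob:
  fixes v :: nat
  assumes "finite E" "F \<subseteq> incident_edges E v"
  defines "D \<equiv> card (incident_edges E v)"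
  shows "measure_pmf.prob (picked_edges_pmf E c v) {A. A \<subseteq> F} =
    (card F choose min c D) / (D choose min c D)"
proof -
  have fin: "finite (incident_edges E v)"
    using assms by (simp add: incident_edges_def)
  have "{A. A \<subseteq> incident_edges E v \<and> card A = min c D} \<inter> {A. A \<subseteq> F} = {A. A \<subseteq> F \<and> card A = min c D}"
    using assms(2) by auto
  then show ?thesis
    using n_subsets[OF finite_subset[OF assms(2) fin]]
    unfolding measure_picked_edges_pmf[OF assms(1)] D_def[symmetric] by simp
qed

text \<open>The exponent \<open>m\<close> may be smaller than the number of picks, so that arbitrarily large \<open>c\<close> can be
  treated by a bound tuned to the threshold.\<close>
lemma pick_subset_prob_le:
  assumes E: "finite E" and F: "F \<subseteq> incident_edges E v"
    and m: "m \<le> min c (card (incident_edges E v))"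
  shows "measure_pmf.prob (picked_edges_pmf E c v) {A. A \<subseteq> F}
           \<le> (card F / card (incident_edges E v)) ^ m"
proof -
  define D where "D = card (incident_edges E v)"
  define k where "k = min c D"
  have fin: "finite (incident_edges E v)"
    using E by (simp add: incident_edges_def)
  have le: "card F \<le> D" unfolding D_def using F fin by (rule card_mono[rotated])
  show ?thesis
  proof (cases "D = 0")
    case True
    then show ?thesis using m by (simp add: D_def)
  next
    case False
    have pos: "0 < D choose k" by (simp add: k_def)
    have "real (card F choose k) * real D ^ k \<le> real (D choose k) * real (card F) ^ k"
      using binomial_ratio_le[OF le, of k] by (simp only: of_nat_le_iff of_nat_mult[symmetric] of_nat_power[symmetric])
    then have "(card F choose k) / (D choose k) \<le> (card F / D) ^ k"
      using pos False by (simp add: field_simps power_divide)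
    also have "\<dots> \<le> (card F / D) ^ m"
      using le False m by (intro power_decreasing) (auto simp: k_def D_def)
    finally show ?thesis
      using pick_subset_prob[OF E F, of c] by (simp add: D_def k_def)
  qed
qed

text \<open>A vertex avoids \<open>q\<close> given neighbours: each of its picks does so with probability at least
  \<open>1 - q / (D - c) \<ge> exp (- 2 q / (D - c))\<close>.\<close>
lemma pick_subset_prob_ge:
  assumes E: "finite E" and F: "F \<subseteq> incident_edges E v"
    and D: "card (incident_edges E v) = card F + q" and c: "c + 2 * q \<le> card (incident_edges E v)"
    and c': "c < card (incident_edges E v)"
  shows "exp (- 2 * real c * real q / (real (card (incident_edges E v)) - real c))
           \<le> measure_pmf.prob (picked_edges_pmf E c v) {A. A \<subseteq> F}"
proof -
  define D where "D = card (incident_edges E v)"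
  define f where "f = card F"
  have Dfq: "D = f + q" using D by (simp add: D_def f_def)
  have cD: "c + 2 * q \<le> D" "c < D" using c c' by (auto simp: D_def)
  have pos: "0 < D choose c" using cD by simp
  have cf: "c \<le> f" "f \<le> D" using Dfq cD by linarith+
  let ?x = "real q / (real D - real c)"
  have half: "?x \<le> 1/2" using cD by (simp add: divide_le_eq)
  have "exp (- 2 * real c * real q / (real D - real c)) = exp (- 2 * ?x) ^ c"
    by (simp add: exp_of_nat_mult[symmetric] algebra_simps)
  also have "\<dots> \<le> (1 - ?x) ^ c"
    using cD half by (intro power_mono one_minus_ge_exp) auto
  also have "1 - ?x = real (f - c) / real (D - c)"
    using cD cf Dfq by (simp add: of_nat_diff field_simps)
  also have "(\<dots>) ^ c \<le> (f choose c) / (D choose c)"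
  proof -
    have "real (D choose c) * real (f - c) ^ c \<le> real (f choose c) * real (D - c) ^ c"
      using binomial_ratio_ge[OF cf(2) order_refl cf(1)]
      by (simp only: of_nat_le_iff of_nat_mult[symmetric] of_nat_power[symmetric])
    then show ?thesis
      using pos cD by (simp add: field_simps power_divide)
  qed
  finally show ?thesis
    using pick_subset_prob[OF E F, of c] cD by (simp add: D_def f_def min_absorb1)
qed

text \<open>Here \<open>D choose c \<le> D\<^sup>c / c!\<close> and \<open>c! \<ge> (c / e)\<^sup>c\<close>. The factor \<open>c\<^sup>c\<close> gained from the factorial
  must be kept: it is what halves the exponent at the threshold.\<close>
lemma pick_exact_prob_ge:
  assumes E: "finite E" and S: "S \<subseteq> incident_edges E v" "card S = c" and c: "0 < c"
    and D: "real (card (incident_edges E v)) \<le> \<Delta>"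
  shows "(real c / (exp 1 * \<Delta>)) ^ c \<le> measure_pmf.prob (picked_edges_pmf E c v) {S}"
proof -
  define D where "D = card (incident_edges E v)"
  have fin: "finite (incident_edges E v)"
    using E by (simp add: incident_edges_def)
  have cD: "c \<le> D" using card_mono[OF fin S(1)] S(2) by (simp add: D_def)
  have pos: "0 < D choose c" using cD by simp
  have "measure_pmf.prob (picked_edges_pmf E c v) {S} = 1 / (D choose c)"
  proof -
    have "{A. A \<subseteq> incident_edges E v \<and> card A = min c D} \<inter> {S} = {S}"
      using S cD by (auto simp: min_absorb1)
    then show ?thesis
      unfolding measure_picked_edges_pmf[OF E] D_def[symmetric] using cD by (simp add: min_absorb1)
  qed
  moreover have "(real c / (exp 1 * \<Delta>)) ^ c \<le> 1 / (D choose c)"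
  proof -
    have D0: "0 < D" "real D \<le> \<Delta>" using c cD D by (auto simp: D_def)
    have "real (D choose c) * fact c \<le> real D ^ c"
    proof -
      have "real ((D choose c) * fact c) \<le> real (D ^ c)"
        by (simp only: of_nat_le_iff binomial_fact_pow)
      then show ?thesis by simp
    qed
    also have "\<dots> \<le> \<Delta> ^ c" using D0 by (intro power_mono) auto
    finally have "real (D choose c) * fact c * real c ^ c \<le> \<Delta> ^ c * (exp (real c) * fact c)"
      using D0 by (intro mult_mono power_le_exp_fact) auto
    then have "fact c * (real (D choose c) * real c ^ c) \<le> fact c * (\<Delta> ^ c * exp (real c))"
      by (simp add: algebra_simps)
    then have "real (D choose c) * real c ^ c \<le> \<Delta> ^ c * exp (real c)"
      by (subst (asm) mult_le_cancel_left_pos) auto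
    moreover have "exp (real c) = exp 1 ^ c" by (simp add: exp_of_nat_mult[symmetric])
    ultimately show ?thesis
      using pos D0 by (simp add: field_simps power_divide power_mult_distrib)
  qed
  ultimately show ?thesis by simp
qed

section \<open>Walks through connected vertex sets\<close>

text \<open>Connectivity of the subgraph induced on \<open>T\<close>, expressed by cuts: this is the form in which it is
  both used (to grow a walk) and verified (for components).\<close>
definition connected_set :: "nat set set \<Rightarrow> nat set \<Rightarrow> bool" where
  "connected_set E T \<longleftrightarrow> T \<noteq> {} \<and>
     (\<forall>S. S \<noteq> {} \<and> S \<subset> T \<longrightarrow> (\<exists>u\<in>S. \<exists>w\<in>T - S. {u, w} \<in> E))"

definition walk :: "nat set set \<Rightarrow> nat list \<Rightarrow> bool" where
  "walk E = successively (\<lambda>u v. {u, v} \<in> E)"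

lemma walk_detour:
  assumes "walk E (xs @ [u] @ ys)" "{u, w} \<in> E"
  shows "walk E (xs @ [u, w, u] @ ys)"
  using assms unfolding walk_def
  by (auto simp: successively_append_iff insert_commute successively_Cons)

text \<open>Grow the walk one vertex at a time: a new vertex \<open>w\<close> adjacent to a visited \<open>u\<close> is inserted as the
  detour \<open>u, w, u\<close>, which costs two steps.\<close>
lemma connected_set_walk:
  assumes T: "connected_set E T" "finite T"
  shows "\<exists>xs. walk E xs \<and> set xs = T \<and> length xs = 2 * (card T - 1) + 1"
proof -
  have "\<exists>xs. walk E xs \<and> set xs \<subseteq> T \<and> card (set xs) = Suc k \<and> length xs = 2 * k + 1"
    if "Suc k \<le> card T" for k
    using that
  proof (induction k)
    case 0
    obtain t where "t \<in> T" using T by (auto simp: connected_set_def)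
    then show ?case by (intro exI[of _ "[t]"]) (auto simp: walk_def)
  next
    case (Suc k)
    then obtain xs where xs: "walk E xs" "set xs \<subseteq> T" "card (set xs) = Suc k" "length xs = 2 * k + 1"
      by auto
    then have "set xs \<subset> T" "set xs \<noteq> {}" using Suc.prems by auto
    then obtain u w where uw: "u \<in> set xs" "w \<in> T - set xs" "{u, w} \<in> E"
      using T(1) unfolding connected_set_def by meson
    obtain ys zs where "xs = ys @ [u] @ zs" using split_list[OF uw(1)] by auto
    then have "walk E (ys @ [u, w, u] @ zs)" "set (ys @ [u, w, u] @ zs) = insert w (set xs)"
      "length (ys @ [u, w, u] @ zs) = 2 * Suc k + 1"
      using walk_detour[of E ys u zs w] xs uw by auto
    then show ?case using xs uw
      by (intro exI[of _ "ys @ [u, w, u] @ zs"]) auto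
  qed
  from this[of "card T - 1"] obtain xs where
    "walk E xs" "set xs \<subseteq> T" "card (set xs) = card T" "length xs = 2 * (card T - 1) + 1"
    using T by (auto simp: connected_set_def card_gt_0_iff Suc_le_eq)
  then show ?thesis using card_subset_eq[OF T(2)] by blast
qed

lemma card_walks_le:
  assumes V: "finite V" and deg: "\<And>v. v \<in> V \<Longrightarrow> card {w \<in> V. {v, w} \<in> E} \<le> \<Delta>"
  shows "card {xs. walk E xs \<and> set xs \<subseteq> V \<and> length xs = Suc j} \<le> card V * \<Delta> ^ j"
proof (induction j)
  case 0
  have "{xs. walk E xs \<and> set xs \<subseteq> V \<and> length xs = Suc 0} \<subseteq> (\<lambda>v. [v]) ` V"
    by (auto simp: length_Suc_conv)
  then show ?case using surj_card_le[OF V] by simp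
next
  case (Suc j)
  let ?W = "\<lambda>j. {xs. walk E xs \<and> set xs \<subseteq> V \<and> length xs = Suc j}"
  have fin: "finite (?W j)" for j
    by (rule finite_subset[OF _ finite_lists_length_eq[OF V, of "Suc j"]]) auto
  have "?W (Suc j) \<subseteq> (\<Union>xs\<in>?W j. (\<lambda>w. w # xs) ` {w \<in> V. {hd xs, w} \<in> E})"
  proof
    fix ys assume ys: "ys \<in> ?W (Suc j)"
    then obtain w x xs where eq: "ys = w # x # xs" by (auto simp: length_Suc_conv)
    then have "x # xs \<in> ?W j" "w \<in> V" "{hd (x # xs), w} \<in> E"
      using ys by (auto simp: walk_def insert_commute)
    then show "ys \<in> (\<Union>xs\<in>?W j. (\<lambda>w. w # xs) ` {w \<in> V. {hd xs, w} \<in> E})"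
      using eq by blast
  qed
  then have "card (?W (Suc j)) \<le> card (\<Union>xs\<in>?W j. (\<lambda>w. w # xs) ` {w \<in> V. {hd xs, w} \<in> E})"
    using fin V by (intro card_mono) auto
  also have "\<dots> \<le> (\<Sum>xs\<in>?W j. card ((\<lambda>w. w # xs) ` {w \<in> V. {hd xs, w} \<in> E}))"
    by (rule card_UN_le[OF fin])
  also have "\<dots> \<le> (\<Sum>xs\<in>?W j. \<Delta>)"
  proof (intro sum_mono)
    fix xs assume "xs \<in> ?W j"
    then have "hd xs \<in> V" by (cases xs) auto
    then show "card ((\<lambda>w. w # xs) ` {w \<in> V. {hd xs, w} \<in> E}) \<le> \<Delta>"
      using card_image_le[of "{w \<in> V. {hd xs, w} \<in> E}" "\<lambda>w. w # xs"] deg[of "hd xs"] V by simp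
  qed
  also have "\<dots> \<le> card V * \<Delta> ^ Suc j" using Suc.IH by (simp add: mult.commute mult.left_commute)
  finally show ?case .
qed

text \<open>Encoding sets by walks gives a bound exponential in \<open>k\<close>; enumerating the vertices in an order in
  which each is adjacent to an earlier one would cost an extra factor \<open>k!\<close>, which is too much
  for large \<open>k\<close>.\<close>
lemma card_connected_sets_le:
  assumes V: "finite V" and deg: "\<And>v. v \<in> V \<Longrightarrow> card {w \<in> V. {v, w} \<in> E} \<le> \<Delta>"
  shows "card {T. T \<subseteq> V \<and> connected_set E T \<and> card T = k} \<le> card V * \<Delta> ^ (2 * (k - 1))"
proof -
  let ?W = "{xs. walk E xs \<and> set xs \<subseteq> V \<and> length xs = Suc (2 * (k - 1))}"
  have fin: "finite ?W"
    by (rule finite_subset[OF _ finite_lists_length_eq[OF V, of "Suc (2 * (k - 1))"]]) auto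
  have "{T. T \<subseteq> V \<and> connected_set E T \<and> card T = k} \<subseteq> set ` ?W"
  proof safe
    fix T assume T: "T \<subseteq> V" "connected_set E T" "k = card T"
    obtain xs where "walk E xs" "set xs = T" "length xs = 2 * (card T - 1) + 1"
      using connected_set_walk[OF T(2) finite_subset[OF T(1) V]] by blast
    then show "T \<in> set ` {xs. walk E xs \<and> set xs \<subseteq> V \<and> length xs = Suc (2 * (card T - 1))}"
      using T by (auto intro!: image_eqI[of _ _ xs])
  qed
  then have "card {T. T \<subseteq> V \<and> connected_set E T \<and> card T = k} \<le> card ?W"
    by (rule surj_card_le[OF fin])
  also have "\<dots> \<le> card V * \<Delta> ^ (2 * (k - 1))" by (rule card_walks_le[OF V deg])
  finally show ?thesis .
qed

section \<open>Independent events and separated elements\<close>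

text \<open>The product rule for intersections passes to complements, by exchanging one event at a time for its
  complement.\<close>
lemma prob_no_event_eq_prod:
  fixes M :: "'a pmf" and I :: "'j \<Rightarrow> 'a set"
  assumes J: "finite J"
    and ind: "\<And>K. K \<subseteq> J \<Longrightarrow> measure_pmf.prob M {x. \<forall>j\<in>K. x \<in> I j} = (\<Prod>j\<in>K. measure_pmf.prob M (I j))"
  shows "measure_pmf.prob M {x. \<forall>j\<in>J. x \<notin> I j} = (\<Prod>j\<in>J. 1 - measure_pmf.prob M (I j))"
proof -
  have "measure_pmf.prob M {x. (\<forall>j\<in>K. x \<in> I j) \<and> (\<forall>j\<in>L. x \<notin> I j)} =
      (\<Prod>j\<in>K. measure_pmf.prob M (I j)) * (\<Prod>j\<in>L. 1 - measure_pmf.prob M (I j))"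
    if "finite L" "K \<inter> L = {}" "K \<union> L \<subseteq> J" for K L
    using that
  proof (induction L arbitrary: K)
    case empty
    then show ?case using ind[of K] by simp
  next
    case (insert l L)
    have finK: "finite K" using insert.prems J by (meson finite_subset le_sup_iff)
    let ?X = "\<lambda>K. {x. (\<forall>j\<in>K. x \<in> I j) \<and> (\<forall>j\<in>L. x \<notin> I j)}"
    have "{x. (\<forall>j\<in>K. x \<in> I j) \<and> (\<forall>j\<in>insert l L. x \<notin> I j)} = ?X K - ?X (insert l K)" by auto
    then have "measure_pmf.prob M {x. (\<forall>j\<in>K. x \<in> I j) \<and> (\<forall>j\<in>insert l L. x \<notin> I j)} =
        measure_pmf.prob M (?X K) - measure_pmf.prob M (?X (insert l K))"
      by (simp add: measure_pmf.finite_measure_Diff Collect_mono)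
    also have "measure_pmf.prob M (?X K) = (\<Prod>j\<in>K. measure_pmf.prob M (I j)) * (\<Prod>j\<in>L. 1 - measure_pmf.prob M (I j))"
      using insert.prems by (intro insert.IH) auto
    also have "measure_pmf.prob M (?X (insert l K)) = (\<Prod>j\<in>insert l K. measure_pmf.prob M (I j)) * (\<Prod>j\<in>L. 1 - measure_pmf.prob M (I j))"
      using insert.prems insert.hyps by (intro insert.IH) auto
    also have "(\<Prod>j\<in>insert l K. measure_pmf.prob M (I j)) = measure_pmf.prob M (I l) * (\<Prod>j\<in>K. measure_pmf.prob M (I j))"
      using insert.prems finK by (subst prod.insert) auto
    finally show ?case using insert.hyps by (simp add: algebra_simps)
  qed
  from this[of J "{}"] show ?thesis using J by simp
qed

text \<open>A separated subset of maximal size dominates \<open>V\<close>, since any vertex outside its neighbourhood could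
  be added.\<close>
lemma exists_large_separated_subset:
  assumes V: "finite V" and refl: "\<And>v. v \<in> V \<Longrightarrow> R v v"
    and sym: "\<And>v w. R v w \<Longrightarrow> R w v"
    and deg: "\<And>v. v \<in> V \<Longrightarrow> card {w \<in> V. R v w} \<le> K"
  shows "\<exists>J \<subseteq> V. (\<forall>v\<in>J. \<forall>w\<in>J. v \<noteq> w \<longrightarrow> \<not> R v w) \<and> card V \<le> K * card J"
proof -
  let ?P = "\<lambda>J. J \<subseteq> V \<and> (\<forall>v\<in>J. \<forall>w\<in>J. v \<noteq> w \<longrightarrow> \<not> R v w)"
  have bound: "card J < Suc (card V)" if "?P J" for J
    using that card_mono[OF V, of J] by simp
  obtain J where J: "?P J" and max: "\<And>J'. ?P J' \<Longrightarrow> card J' \<le> card J"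
    using ex_has_greatest_nat[of ?P "{}" card "Suc (card V)"] bound by fastforce
  have "V \<subseteq> (\<Union>v\<in>J. {w \<in> V. R v w})"
  proof (rule ccontr)
    assume "\<not> ?thesis"
    then obtain w where w: "w \<in> V" "\<forall>v\<in>J. \<not> R v w" by blast
    have "\<not> R w v" if "v \<in> J" for v using w(2) sym[of w v] that by auto
    then have "?P (insert w J)" using J w by simp
    then have "card (insert w J) \<le> card J" by (rule max)
    moreover have "finite J" using J V by (auto intro: finite_subset)
    ultimately have "w \<in> J" by (auto simp: card_insert_if split: if_splits)
    then show False using w refl by blast
  qed
  moreover have finJ: "finite J" using J V by (auto intro: finite_subset)
  ultimately have "card V \<le> card (\<Union>v\<in>J. {w \<in> V. R v w})"
    using V by (intro card_mono) auto
  also have "\<dots> \<le> (\<Sum>v\<in>J. card {w \<in> V. R v w})" by (rule card_UN_le[OF finJ])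
  also have "\<dots> \<le> (\<Sum>v\<in>J. K)" using J by (intro sum_mono deg) auto
  finally show ?thesis using J by (auto simp: mult.commute)
qed

section \<open>Graphs spread over boxes\<close>

text \<open>A closed set is a union of connected components; unlike components, closed sets are stable
  under complement.\<close>
definition closed_in :: "nat set set \<Rightarrow> nat set \<Rightarrow> bool" where
  "closed_in H T \<longleftrightarrow> (\<forall>e\<in>H. e \<subseteq> T \<or> e \<inter> T = {})"

lemma closed_inD: "closed_in H T \<Longrightarrow> e \<in> H \<Longrightarrow> e \<subseteq> T \<or> e \<inter> T = {}"
  by (simp add: closed_in_def)

text \<open>The properties of a geometric graph with well distributed points that the argument needs. The vertices
  are grouped in boxes of \<open>\<Theta>(\<mu>)\<close> vertices, two touching boxes together form a clique, edges
  only join boxes that are near each other, a bounded number \<open>C\<close> of boxes is near a given one, and any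
  two occupied boxes are linked by a chain of touching ones.\<close>
locale boxed_graph =
  fixes n :: nat and E :: "nat set set" and box :: "nat \<Rightarrow> 'b"
    and touch :: "'b \<Rightarrow> 'b \<Rightarrow> bool" and near :: "'b \<Rightarrow> 'b set" and \<mu> :: real and C :: nat
  assumes edges: "e \<in> E \<Longrightarrow> \<exists>u v. u \<in> {1..n} \<and> v \<in> {1..n} \<and> u \<noteq> v \<and> e = {u, v}"
    and touch_refl: "touch b b"
    and touch_edge: "u \<in> {1..n} \<Longrightarrow> v \<in> {1..n} \<Longrightarrow> u \<noteq> v \<Longrightarrow> touch (box u) (box v) \<Longrightarrow> {u, v} \<in> E"
    and near_edge: "{u, v} \<in> E \<Longrightarrow> box v \<in> near (box u)"
    and near_refl: "b \<in> near b"
    and near_sym: "b \<in> near b' \<Longrightarrow> b' \<in> near b"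
    and near_finite: "finite (near b)"
    and near_card: "card (near b) \<le> C"
    and box_ge: "u \<in> {1..n} \<Longrightarrow> \<mu> / 4 \<le> card {v \<in> {1..n}. box v = box u}"
    and box_le: "card {v \<in> {1..n}. box v = b} \<le> 4 * \<mu>"
    and linked: "u \<in> {1..n} \<Longrightarrow> v \<in> {1..n} \<Longrightarrow>
      (u, v) \<in> {(x, y). x \<in> {1..n} \<and> y \<in> {1..n} \<and> touch (box x) (box y)}\<^sup>*"
    and mu_ge: "20 \<le> \<mu>"
begin

abbreviation V :: "nat set" where "V \<equiv> {1..n}"

definition nbrs :: "nat \<Rightarrow> nat set" where "nbrs v = {w \<in> V. {v, w} \<in> E}"

definition \<Delta> :: real where "\<Delta> = 4 * real C * \<mu>"

lemma E_subset: "E \<subseteq> Pow V"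
  using edges by blast

lemma finite_E: "finite E"
  by (rule finite_subset[OF E_subset]) simp

lemma edge_ends: "{u, v} \<in> E \<Longrightarrow> u \<in> V \<and> v \<in> V \<and> u \<noteq> v"
  using edges[of "{u, v}"] by (auto simp: doubleton_eq_iff)

lemma nbrs_finite: "finite (nbrs v)" "nbrs v \<subseteq> V"
  by (auto simp: nbrs_def)

lemma incident_eq: "incident_edges E v = (\<lambda>w. {v, w}) ` nbrs v"
proof -
  have "e \<in> (\<lambda>w. {v, w}) ` nbrs v" if e: "e \<in> E" "v \<in> e" for e
  proof -
    obtain x y where "x \<in> V" "y \<in> V" "x \<noteq> y" "e = {x, y}" using edges[OF e(1)] by blast
    then show ?thesis using e by (auto simp: nbrs_def insert_commute)
  qed
  then show ?thesis by (auto simp: incident_edges_def nbrs_def)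
qed

lemma inj_edge: "inj_on (\<lambda>w. {v, w}) X"
  by (auto simp: inj_on_def doubleton_eq_iff)

lemma card_incident: "card (incident_edges E v) = card (nbrs v)"
  unfolding incident_eq by (rule card_image[OF inj_edge])

lemma C_ge: "1 \<le> C"
proof -
  have "near (box 0) \<noteq> {}" using near_refl by blast
  then show ?thesis using near_card[of "box 0"] near_finite[of "box 0"]
    by (metis One_nat_def Suc_leI card_gt_0_iff le_trans)
qed

lemma Delta_ge: "1 \<le> \<Delta>"
proof -
  have "1 * 1 \<le> (4 * real C) * \<mu>" using C_ge mu_ge by (intro mult_mono) auto
  then show ?thesis by (simp add: \<Delta>_def)
qed

text \<open>A vertex set with at most \<open>x\<close> vertices in each box meets the surroundings of a box, hence
  the neighbourhood of a vertex, in at most \<open>C x\<close> vertices.\<close>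
lemma near_count:
  fixes x :: real
  assumes "T \<subseteq> V" "\<And>b. card {w \<in> T. box w = b} \<le> x"
  shows "card {w \<in> T. box w \<in> near b} \<le> C * x"
proof -
  have fin: "finite {w \<in> T. box w = b}" for b using assms(1) finite_subset by fastforce
  have eq: "{w \<in> T. box w \<in> near b} = (\<Union>b'\<in>near b. {w \<in> T. box w = b'})" by auto
  have "card {w \<in> T. box w \<in> near b} \<le> (\<Sum>b'\<in>near b. card {w \<in> T. box w = b'})"
    unfolding eq by (rule card_UN_le[OF near_finite])
  then have "real (card {w \<in> T. box w \<in> near b}) \<le> (\<Sum>b'\<in>near b. real (card {w \<in> T. box w = b'}))"
    by (simp only: of_nat_sum[symmetric] of_nat_le_iff)
  also have "\<dots> \<le> (\<Sum>b'\<in>near b. x)" by (intro sum_mono assms)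
  also have "\<dots> = card (near b) * x" by simp
  also have "\<dots> \<le> C * x"
    using near_card assms(2)[of b] by (intro mult_right_mono) (auto intro: order_trans[OF of_nat_0_le_iff])
  finally show ?thesis .
qed

lemma near_V_le: "card {w \<in> V. box w \<in> near b} \<le> \<Delta>"
  using near_count[OF order_refl box_le] by (simp add: \<Delta>_def algebra_simps)

lemma nbrs_near: "nbrs v \<subseteq> {w \<in> V. box w \<in> near (box v)}"
  using near_edge by (auto simp: nbrs_def)

lemma deg_le: "card (nbrs v) \<le> \<Delta>"
proof -
  have "card (nbrs v) \<le> card {w \<in> V. box w \<in> near (box v)}"
    by (intro card_mono nbrs_near) simp
  then show ?thesis using near_V_le[of "box v"] by linarith
qed

lemma deg_ge:
  assumes "v \<in> V"
  shows "\<mu> / 5 \<le> card (nbrs v)"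
proof -
  let ?B = "{w \<in> V. box w = box v}"
  \<comment> \<open>The box of \<open>v\<close> is a clique, and \<open>\<mu> / 4 - 1 \<ge> \<mu> / 5\<close> because \<open>\<mu> \<ge> 20\<close>.\<close>
  have "?B - {v} \<subseteq> nbrs v"
  proof
    fix w assume "w \<in> ?B - {v}"
    then show "w \<in> nbrs v" using touch_edge[of v w] assms touch_refl[of "box v"]
      by (auto simp: nbrs_def)
  qed
  then have "card (?B - {v}) \<le> card (nbrs v)" by (rule card_mono[OF nbrs_finite(1)])
  then have "card ?B \<le> card (nbrs v) + 1" using assms by simp
  then show ?thesis using box_ge[OF assms] mu_ge by linarith
qed

lemma picked_support:
  assumes "A \<in> set_pmf (picked_edges_pmf E c v)"
  shows "A \<subseteq> incident_edges E v" "card A = min c (card (nbrs v))"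
  using assms unfolding picked_edges_pmf_support[OF finite_E] card_incident by auto

text \<open>The picks at different vertices are independent, so an event that forces the pick at each
  vertex of \<open>W\<close> into a prescribed set has at most the product probability.\<close>
lemma irrigation_prob_le:
  assumes W: "W \<subseteq> V"
    and X: "\<And>A. (\<And>v. v \<in> V \<Longrightarrow> A v \<in> set_pmf (picked_edges_pmf E c v)) \<Longrightarrow> (\<Union>v\<in>V. A v) \<in> X
       \<Longrightarrow> (\<And>v. v \<in> W \<Longrightarrow> A v \<in> B v)"
  shows "measure_pmf.prob (irrigation_pmf n c E) X
    \<le> (\<Prod>v\<in>W. measure_pmf.prob (picked_edges_pmf E c v) (B v))"
proof -
  let ?P = "Pi_pmf V {} (picked_edges_pmf E c)"
  let ?B = "\<lambda>v. if v \<in> W then B v else UNIV"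
  have "measure_pmf.prob (irrigation_pmf n c E) X = measure_pmf.prob ?P ((\<lambda>A. \<Union>v\<in>V. A v) -` X)"
    unfolding irrigation_pmf_def by simp
  also have "\<dots> \<le> measure_pmf.prob ?P (Pi V ?B)"
  proof (rule measure_pmf.finite_measure_mono_AE)
    show "AE A in ?P. A \<in> (\<lambda>A. \<Union>v\<in>V. A v) -` X \<longrightarrow> A \<in> Pi V ?B"
      unfolding AE_measure_pmf_iff
    proof (intro ballI impI)
      fix A assume "A \<in> set_pmf ?P" "A \<in> (\<lambda>A. \<Union>v\<in>V. A v) -` X"
      then have "\<And>v. v \<in> V \<Longrightarrow> A v \<in> set_pmf (picked_edges_pmf E c v)" "(\<Union>v\<in>V. A v) \<in> X"
        by (auto simp: set_Pi_pmf PiE_dflt_def)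
      then show "A \<in> Pi V ?B" using X[of A] by auto
    qed
  qed simp
  also have "\<dots> = (\<Prod>v\<in>V. measure_pmf.prob (picked_edges_pmf E c v) (?B v))"
    by (rule measure_Pi_pmf_Pi) simp
  also have "\<dots> = (\<Prod>v\<in>W. measure_pmf.prob (picked_edges_pmf E c v) (?B v))"
    using W by (intro prod.mono_neutral_right) (auto simp: measure_pmf.prob_space[unfolded space_measure_pmf])
  also have "\<dots> = (\<Prod>v\<in>W. measure_pmf.prob (picked_edges_pmf E c v) (B v))"
    by (intro prod.cong) auto
  finally show ?thesis .
qed

lemma irrigation_support:
  assumes "H \<in> set_pmf (irrigation_pmf n c E)"
  shows "H \<subseteq> E" "v \<in> V \<Longrightarrow> min c (card (nbrs v)) \<le> card {w. {v, w} \<in> H}"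
proof -
  obtain A where A: "H = (\<Union>v\<in>V. A v)" "\<And>v. v \<in> V \<Longrightarrow> A v \<in> set_pmf (picked_edges_pmf E c v)"
    using assms by (auto simp: irrigation_pmf_def set_Pi_pmf PiE_dflt_def)
  show HE: "H \<subseteq> E"
    using A picked_support(1) by (fastforce simp: incident_edges_def)
  assume v: "v \<in> V"
  have sub: "A v \<subseteq> (\<lambda>w. {v, w}) ` {w. {v, w} \<in> H}"
  proof
    fix e assume e: "e \<in> A v"
    then obtain w where w: "e = {v, w}"
      using picked_support(1)[OF A(2)[OF v]] unfolding incident_eq by blast
    moreover have "e \<in> H" using A(1) e v by blast
    ultimately show "e \<in> (\<lambda>w. {v, w}) ` {w. {v, w} \<in> H}" by blast
  qed
  moreover have fin: "finite {w. {v, w} \<in> H}"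
    by (rule finite_subset[of _ V]) (use HE edge_ends in auto)
  ultimately have "card (A v) \<le> card {w. {v, w} \<in> H}" by (intro surj_card_le) auto
  then show "min c (card (nbrs v)) \<le> card {w. {v, w} \<in> H}"
    using picked_support(2)[OF A(2)[OF v]] by simp
qed

text \<open>Every vertex of a closed set \<open>T\<close> makes at least \<open>m\<close> picks, all of them among its neighbours in \<open>T\<close>.\<close>
lemma prob_closed_le:
  assumes T: "T \<subseteq> V" and m: "m \<le> c" "real m \<le> \<mu> / 5"
    and q: "\<And>v. v \<in> T \<Longrightarrow> card {w \<in> T. {v, w} \<in> E} / (\<mu> / 5) \<le> q"
  shows "measure_pmf.prob (irrigation_pmf n c E) {H. closed_in H T} \<le> q ^ (m * card T)"
proof -
  let ?F = "\<lambda>v. (\<lambda>w. {v, w}) ` {w \<in> T. {v, w} \<in> E}"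
  have F: "?F v \<subseteq> incident_edges E v" for v by (auto simp: incident_edges_def)
  have "measure_pmf.prob (irrigation_pmf n c E) {H. closed_in H T}
     \<le> (\<Prod>v\<in>T. measure_pmf.prob (picked_edges_pmf E c v) {A. A \<subseteq> ?F v})"
  proof (rule irrigation_prob_le[OF T])
    fix A v
    assume A: "\<And>v. v \<in> V \<Longrightarrow> A v \<in> set_pmf (picked_edges_pmf E c v)"
      and cl: "(\<Union>v\<in>V. A v) \<in> {H. closed_in H T}" and v: "v \<in> T"
    have "e \<in> ?F v" if e: "e \<in> A v" for e
    proof -
      obtain w where w: "e = {v, w}" "w \<in> nbrs v"
        using picked_support(1)[OF A] e v T unfolding incident_eq by blast
      have "e \<subseteq> T \<or> e \<inter> T = {}" using cl e v T unfolding closed_in_def by blast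
      then have "w \<in> T" using w v by auto
      then show ?thesis using w by (auto simp: nbrs_def)
    qed
    then show "A v \<in> {A. A \<subseteq> ?F v}" by blast
  qed
  also have "\<dots> \<le> (\<Prod>v\<in>T. q ^ m)"
  proof (intro prod_mono conjI)
    fix v assume v: "v \<in> T"
    then have vV: "v \<in> V" using T by blast
    have deg: "\<mu> / 5 \<le> card (nbrs v)" by (rule deg_ge[OF vV])
    have "m \<le> min c (card (incident_edges E v))"
      using m deg by (simp add: card_incident)
    then have "measure_pmf.prob (picked_edges_pmf E c v) {A. A \<subseteq> ?F v}
      \<le> (card (?F v) / card (incident_edges E v)) ^ m"
      by (intro pick_subset_prob_le finite_E F)
    also have "\<dots> \<le> q ^ m"
    proof (rule power_mono)
      have "real (card (?F v)) / card (incident_edges E v) \<le> card {w \<in> T. {v, w} \<in> E} / (\<mu> / 5)"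
        using deg mu_ge unfolding card_image[OF inj_edge] card_incident
        by (intro divide_left_mono) auto
      also have "\<dots> \<le> q" by (rule q[OF v])
      finally show "real (card (?F v)) / card (incident_edges E v) \<le> q" .
    qed simp
    finally show "measure_pmf.prob (picked_edges_pmf E c v) {A. A \<subseteq> ?F v} \<le> q ^ m" .
  qed simp
  also have "\<dots> = q ^ (m * card T)" by (simp add: power_mult)
  finally show ?thesis .
qed

text \<open>Only the picks made in \<open>A\<close> are used: at least \<open>a\<close> vertices make \<open>m\<close> picks each, and each pick
  avoids \<open>B\<close> with probability at most \<open>1 - a / \<Delta>\<close>.\<close>
lemma prob_no_crossing_le:
  fixes a :: real
  assumes A: "A \<subseteq> V" "B \<subseteq> V" and AB: "\<And>u w. u \<in> A \<Longrightarrow> w \<in> B \<Longrightarrow> {u, w} \<in> E"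
    and a: "0 \<le> a" "a \<le> card A" "a \<le> card B" and m: "m \<le> c" "real m \<le> \<mu> / 5"
  shows "measure_pmf.prob (irrigation_pmf n c E) {H. \<forall>u\<in>A. \<forall>w\<in>B. {u, w} \<notin> H}
    \<le> exp (- real m * a\<^sup>2 / \<Delta>)"
proof -
  let ?F = "\<lambda>v. (\<lambda>w. {v, w}) ` (nbrs v - B)"
  have F: "?F v \<subseteq> incident_edges E v" for v by (auto simp: incident_eq)
  have "measure_pmf.prob (irrigation_pmf n c E) {H. \<forall>u\<in>A. \<forall>w\<in>B. {u, w} \<notin> H}
     \<le> (\<Prod>v\<in>A. measure_pmf.prob (picked_edges_pmf E c v) {A. A \<subseteq> ?F v})"
  proof (rule irrigation_prob_le[OF A(1)])
    fix K v
    assume K: "\<And>v. v \<in> V \<Longrightarrow> K v \<in> set_pmf (picked_edges_pmf E c v)"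
      and X: "(\<Union>v\<in>V. K v) \<in> {H. \<forall>u\<in>A. \<forall>w\<in>B. {u, w} \<notin> H}" and v: "v \<in> A"
    have vV: "v \<in> V" using v A by blast
    have "e \<in> ?F v" if e: "e \<in> K v" for e
    proof -
      obtain w where w: "e = {v, w}" "w \<in> nbrs v"
        using picked_support(1)[OF K[OF vV]] e unfolding incident_eq by blast
      have "w \<notin> B" using X e w vV v by blast
      then show ?thesis using w by auto
    qed
    then show "K v \<in> {A. A \<subseteq> ?F v}" by blast
  qed
  also have "\<dots> \<le> (\<Prod>v\<in>A. exp (- real m * a / \<Delta>))"
  proof (intro prod_mono conjI)
    fix v assume v: "v \<in> A"
    then have vV: "v \<in> V" using A by blast
    have B: "B \<subseteq> nbrs v" using AB[OF v] A(2) by (auto simp: nbrs_def)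
    have deg: "\<mu> / 5 \<le> card (nbrs v)" by (rule deg_ge[OF vV])
    then have pos: "0 < real (card (nbrs v))" using mu_ge by linarith
    have "m \<le> min c (card (incident_edges E v))"
      using m deg by (simp add: card_incident)
    then have "measure_pmf.prob (picked_edges_pmf E c v) {A. A \<subseteq> ?F v}
      \<le> (card (?F v) / card (incident_edges E v)) ^ m"
      by (intro pick_subset_prob_le finite_E F)
    also have "\<dots> \<le> exp (- (a / \<Delta>)) ^ m"
    proof (rule power_mono)
      have "real (card (?F v)) / card (incident_edges E v) = 1 - card B / card (nbrs v)"
        unfolding card_image[OF inj_edge] card_incident
        using card_Diff_subset[OF finite_subset[OF B nbrs_finite(1)] B] card_mono[OF nbrs_finite(1) B] pos
        by (simp add: of_nat_diff diff_divide_distrib)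
      also have "\<dots> \<le> 1 - a / \<Delta>"
        using a deg_le[of v] pos by (intro diff_left_mono frac_le) auto
      also have "\<dots> \<le> exp (- (a / \<Delta>))" using exp_ge_add_one_self[of "- (a / \<Delta>)"] by simp
      finally show "real (card (?F v)) / card (incident_edges E v) \<le> exp (- (a / \<Delta>))" .
    qed simp
    also have "\<dots> = exp (- real m * a / \<Delta>)" by (simp add: exp_of_nat_mult[symmetric])
    finally show "measure_pmf.prob (picked_edges_pmf E c v) {A. A \<subseteq> ?F v} \<le> exp (- real m * a / \<Delta>)" .
  qed simp
  also have "\<dots> = exp (- (real (card A) * (real m * a / \<Delta>)))" by (simp add: exp_of_nat_mult[symmetric])
  also have "\<dots> \<le> exp (- real m * a\<^sup>2 / \<Delta>)"
  proof -
    have "a * (real m * a / \<Delta>) \<le> real (card A) * (real m * a / \<Delta>)"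
      using a Delta_ge by (intro mult_right_mono) auto
    then show ?thesis by (simp add: power2_eq_square algebra_simps)
  qed
  finally show ?thesis .
qed

section \<open>Disconnection forces a split or a sparse component\<close>

definition sparse :: "real \<Rightarrow> nat set \<Rightarrow> bool" where
  "sparse a T \<longleftrightarrow> (\<forall>b. real (card {w \<in> T. box w = b}) < a)"

definition double_box :: "nat \<Rightarrow> nat \<Rightarrow> nat set" where
  "double_box u v = {w \<in> V. box w = box u \<or> box w = box v}"

lemma double_box_edge:
  assumes "touch (box u) (box v)" "x \<in> double_box u v" "y \<in> double_box u v" "x \<noteq> y"
  shows "{x, y} \<in> E"
  using assms touch_edge[of x y] touch_edge[of y x] touch_refl[of "box x"]
  by (auto simp: double_box_def insert_commute)

lemma card_double_box_le: "card (double_box u v) \<le> 8 * \<mu>"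
proof -
  have "double_box u v = {w \<in> V. box w = box u} \<union> {w \<in> V. box w = box v}"
    by (auto simp: double_box_def)
  then have "card (double_box u v) \<le> card {w \<in> V. box w = box u} + card {w \<in> V. box w = box v}"
    by (simp add: card_Un_le)
  then show ?thesis using box_le[of "box u"] box_le[of "box v"] by linarith
qed

text \<open>Applied to \<open>u = v\<close>, the hypothesis says that each box is almost disjoint from \<open>S\<close> or almost contained
  in it; applied to touching boxes, it says that both are of the same kind. The chain of touching boxes
  then makes all boxes of the same kind.\<close>
lemma sparse_or_cosparse:
  fixes a :: real
  assumes S: "S \<subseteq> V" and a: "0 < a" "2 * a \<le> \<mu> / 4"
    and unsplit: "\<And>u v. u \<in> V \<Longrightarrow> v \<in> V \<Longrightarrow> touch (box u) (box v) \<Longrightarrow>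
       card (S \<inter> double_box u v) < a \<or> card (double_box u v - S) < a"
  shows "sparse a S \<or> sparse a (V - S)"
proof -
  let ?P = "\<lambda>u. card {w \<in> S. box w = box u} < a" and ?Q = "\<lambda>u. card {w \<in> V - S. box w = box u} < a"
  have finS: "finite S" using S finite_subset by blast
  have one: "\<not> (?P u \<and> ?Q u)" if "u \<in> V" for u
  proof
    assume PQ: "?P u \<and> ?Q u"
    have "{w \<in> V. box w = box u} = {w \<in> S. box w = box u} \<union> {w \<in> V - S. box w = box u}"
      using S by blast
    then have "card {w \<in> V. box w = box u} \<le> card {w \<in> S. box w = box u} + card {w \<in> V - S. box w = box u}"
      by (simp add: card_Un_le)
    then show False using PQ box_ge[OF that] a by linarith
  qed
  have pass: "?P u \<and> ?P v \<or> ?Q u \<and> ?Q v" if "u \<in> V" "v \<in> V" "touch (box u) (box v)" for u v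
  proof -
    have "real (card {w \<in> S. box w = box x}) \<le> card (S \<inter> double_box u v)"
        "real (card {w \<in> V - S. box w = box x}) \<le> card (double_box u v - S)" if "x = u \<or> x = v" for x
      using S finS that by (auto intro!: card_mono simp: double_box_def)
    from this[of u] this[of v] show ?thesis using unsplit[OF that] by argo
  qed
  have step: "?P u \<longleftrightarrow> ?P v" if "u \<in> V" "v \<in> V" "touch (box u) (box v)" for u v
    using pass[OF that] one[OF that(1)] one[OF that(2)] by blast
  have all: "?P u \<longleftrightarrow> ?P v" if "u \<in> V" "v \<in> V" for u v
    using linked[OF that]
  proof (induction rule: rtrancl_induct)
    case (step y z)
    then show ?case using \<open>\<And>u v. _ \<Longrightarrow> _ \<Longrightarrow> _ \<Longrightarrow> ?P u \<longleftrightarrow> ?P v\<close>[of y z] by blast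
  qed simp
  have dich: "?P u \<or> ?Q u" if "u \<in> V" for u
    using pass[OF that that touch_refl] by blast
  have sp: "sparse a T" if "T \<subseteq> V" "\<And>u. u \<in> V \<Longrightarrow> card {w \<in> T. box w = box u} < a" for T
    unfolding sparse_def
  proof
    fix b
    show "card {w \<in> T. box w = b} < a"
    proof (cases "\<exists>u\<in>V. box u = b")
      case True then show ?thesis using that(2) by blast
    next
      case False
      then have "{w \<in> T. box w = b} = {}" using that(1) by blast
      then show ?thesis using a(1) by (metis card.empty of_nat_0)
    qed
  qed
  show ?thesis
  proof (cases "\<forall>u\<in>V. ?P u")
    case True then show ?thesis using sp[OF S] by blast
  next
    case False
    then have "\<forall>u\<in>V. ?Q u" using all dich by blast
    then show ?thesis using sp[of "V - S"] by blast
  qed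
qed

definition component :: "nat set set \<Rightarrow> nat \<Rightarrow> nat set" where
  "component H t = {w \<in> V. (t, w) \<in> {(a, b). {a, b} \<in> H}\<^sup>*}"

lemma closed_component:
  assumes "H \<subseteq> E" "t \<in> V"
  shows "closed_in H (component H t)"
  unfolding closed_in_def
proof
  let ?R = "{(a, b). {a, b} \<in> H}"
  fix e assume e: "e \<in> H"
  then obtain x y where xy: "x \<in> V" "y \<in> V" "e = {x, y}" using edges assms by blast
  have "(x, y) \<in> ?R" "(y, x) \<in> ?R" using e xy by (auto simp: insert_commute)
  then have "(t, x) \<in> ?R\<^sup>* \<longleftrightarrow> (t, y) \<in> ?R\<^sup>*" by (meson rtrancl.rtrancl_into_rtrancl)
  then show "e \<subseteq> component H t \<or> e \<inter> component H t = {}"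
    using xy by (auto simp: component_def)
qed

lemma connected_component:
  assumes H: "H \<subseteq> E" and t: "t \<in> V"
  shows "connected_set E (component H t)"
  unfolding connected_set_def
proof (intro conjI allI impI)
  let ?R = "{(a, b). {a, b} \<in> H}"
  let ?T = "component H t"
  show "?T \<noteq> {}" using t by (auto simp: component_def)
  fix S assume S: "S \<noteq> {} \<and> S \<subset> ?T"
  \<comment> \<open>A path from inside \<open>S\<close> to outside crosses its boundary.\<close>
  have leave: "\<exists>u\<in>S. \<exists>w. w \<notin> S \<and> (u, w) \<in> ?R" if "(x, y) \<in> ?R\<^sup>*" "x \<in> S" "y \<notin> S" for x y
    using that by (induction rule: rtrancl_induct) auto
  have "sym ?R" by (auto simp: sym_def insert_commute)
  then have sym: "sym (?R\<^sup>*)" by (rule sym_rtrancl)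
  obtain u w where uw: "u \<in> S" "w \<notin> S" "(u, w) \<in> ?R"
  proof (cases "t \<in> S")
    case True
    obtain y where "y \<in> ?T" "y \<notin> S" using S by blast
    then show ?thesis using leave[of t y] True that by (auto simp: component_def)
  next
    case False
    obtain q where q: "q \<in> S" "q \<in> ?T" using S by blast
    then have "(q, t) \<in> ?R\<^sup>*" using sym by (auto simp: component_def dest: symD)
    then show ?thesis using leave[of q t] q False that by blast
  qed
  have "(t, u) \<in> ?R\<^sup>*" using uw S by (auto simp: component_def)
  then have "(t, w) \<in> ?R\<^sup>*" using uw(3) by (rule rtrancl.rtrancl_into_rtrancl)
  moreover have "{u, w} \<in> E" using uw H by blast
  ultimately show "\<exists>u\<in>S. \<exists>w\<in>?T - S. {u, w} \<in> E"
    using uw edge_ends[of u w] by (auto simp: component_def)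
qed

lemma component_subset_closed:
  assumes "closed_in H S" "t \<in> S"
  shows "component H t \<subseteq> S"
proof
  fix w assume "w \<in> component H t"
  then have "(t, w) \<in> {(a, b). {a, b} \<in> H}\<^sup>*" by (simp add: component_def)
  then show "w \<in> S"
    by (induction rule: rtrancl_induct) (use assms in \<open>auto simp: closed_in_def\<close>)
qed

text \<open>If no closed set splits a double box, take a closed proper nonempty set. It or its complement is
  sparse, and a component inside the sparse one has more than \<open>m\<close> vertices because each of its vertices has
  at least \<open>m\<close> neighbours in it.\<close>
lemma disconnected_cases:
  fixes a :: real
  assumes H: "H \<subseteq> E" and deg: "\<And>v. v \<in> V \<Longrightarrow> m \<le> card {w. {v, w} \<in> H}"
    and nc: "\<not> graph_connected n H" and a: "0 < a" "2 * a \<le> \<mu> / 4"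
  shows "(\<exists>u\<in>V. \<exists>v\<in>V. touch (box u) (box v) \<and> (\<exists>A\<subseteq>double_box u v.
             a \<le> card A \<and> a \<le> card (double_box u v - A) \<and>
             (\<forall>x\<in>A. \<forall>y\<in>double_box u v - A. {x, y} \<notin> H))) \<or>
         (\<exists>T\<subseteq>V. m < card T \<and> connected_set E T \<and> sparse a T \<and> closed_in H T)"
proof (cases "\<exists>u\<in>V. \<exists>v\<in>V. touch (box u) (box v) \<and> (\<exists>A\<subseteq>double_box u v.
             a \<le> card A \<and> a \<le> card (double_box u v - A) \<and>
             (\<forall>x\<in>A. \<forall>y\<in>double_box u v - A. {x, y} \<notin> H))")
  case False
  obtain u v where uv: "u \<in> V" "v \<in> V" "(u, v) \<notin> {(a, b). {a, b} \<in> H}\<^sup>*"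
    using nc by (auto simp: graph_connected_def)
  define S where "S = component H u"
  have S: "S \<subseteq> V" "u \<in> S" "v \<notin> S" "closed_in H S"
    using uv closed_component[OF H uv(1)] by (auto simp: S_def component_def)
  have S': "closed_in H (V - S)"
    unfolding closed_in_def
  proof
    fix e assume e: "e \<in> H"
    then have "e \<subseteq> V" using H E_subset by blast
    then show "e \<subseteq> V - S \<or> e \<inter> (V - S) = {}" using closed_inD[OF S(4) e] by blast
  qed
  have "sparse a S \<or> sparse a (V - S)"
  proof (rule sparse_or_cosparse[OF S(1) a])
    fix x y assume xy: "x \<in> V" "y \<in> V" "touch (box x) (box y)"
    let ?U = "double_box x y"
    have diff: "?U - S \<inter> ?U = ?U - S" by blast
    have "{p, q} \<notin> H" if "p \<in> S \<inter> ?U" "q \<in> ?U - S \<inter> ?U" for p q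
    proof
      assume "{p, q} \<in> H"
      then have "{p, q} \<subseteq> S \<or> {p, q} \<inter> S = {}" using S(4) by (rule closed_inD[rotated])
      then show False using that by simp
    qed
    then have "\<not> (a \<le> card (S \<inter> ?U) \<and> a \<le> card (?U - S \<inter> ?U))"
      using False xy inf_le2[of S ?U] by meson
    then have "\<not> (a \<le> card (S \<inter> ?U) \<and> a \<le> card (?U - S))" unfolding diff .
    then show "card (S \<inter> ?U) < a \<or> card (?U - S) < a" by linarith
  qed
  then obtain S' t where S': "S' \<subseteq> V" "closed_in H S'" "sparse a S'" "t \<in> S'"
    using S S' uv(2) by blast
  let ?T = "component H t"
  have t: "t \<in> V" using S' by blast
  have sub: "?T \<subseteq> S'" by (rule component_subset_closed[OF S'(2,4)])
  have TV: "?T \<subseteq> V" by (auto simp: component_def)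
  have finT: "finite ?T" using TV finite_subset by blast
  have finS': "finite S'" using S' finite_subset by blast
  have "sparse a ?T"
    unfolding sparse_def
  proof
    fix b
    have "card {w \<in> ?T. box w = b} \<le> card {w \<in> S'. box w = b}"
      using finS' sub by (intro card_mono) auto
    then show "card {w \<in> ?T. box w = b} < a" using S'(3) unfolding sparse_def
      by (meson le_less_trans of_nat_le_iff)
  qed
  moreover have "m < card ?T"
  proof -
    have tT: "t \<in> ?T" using t by (simp add: component_def)
    have "{w. {t, w} \<in> H} \<subseteq> ?T - {t}"
    proof
      fix w assume w: "w \<in> {w. {t, w} \<in> H}"
      then have "t \<noteq> w" using H edge_ends[of t w] by blast
      moreover have "{t, w} \<subseteq> ?T \<or> {t, w} \<inter> ?T = {}"
        using w by (intro closed_inD[OF closed_component[OF H t]]) simp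
      ultimately show "w \<in> ?T - {t}" using tT by simp
    qed
    then have "m \<le> card (?T - {t})" using deg[OF t] finT
      by (meson card_mono finite_Diff le_trans)
    then show ?thesis using tT finT by (metis card_Diff1_less le_less_trans)
  qed
  ultimately show ?thesis
    using TV connected_component[OF H t] closed_component[OF H t] by blast
qed blast

text \<open>Union bound over at most \<open>n\<^sup>2\<close> double boxes and \<open>2\<^bsup>8 \<mu>\<^esup>\<close> ways to cut each of them.\<close>
lemma prob_split_le:
  fixes a :: real
  assumes a: "0 \<le> a" and m: "m \<le> c" "real m \<le> \<mu> / 5"
  shows "measure_pmf.prob (irrigation_pmf n c E)
     {H. \<exists>u\<in>V. \<exists>v\<in>V. touch (box u) (box v) \<and> (\<exists>A\<subseteq>double_box u v.
             a \<le> card A \<and> a \<le> card (double_box u v - A) \<and>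
             (\<forall>x\<in>A. \<forall>y\<in>double_box u v - A. {x, y} \<notin> H))}
     \<le> (real n)\<^sup>2 * exp (8 * \<mu>) * exp (- real m * a\<^sup>2 / \<Delta>)" (is "measure_pmf.prob _ ?X \<le> _")
proof -
  let ?P = "measure_pmf.prob (irrigation_pmf n c E)"
  define I where "I = (\<Union>u\<in>V. \<Union>v\<in>V. (\<lambda>A. (A, double_box u v - A)) `
     {A. A \<subseteq> double_box u v \<and> touch (box u) (box v) \<and> a \<le> card A \<and> a \<le> card (double_box u v - A)})"
  let ?N = "\<lambda>p. {H. \<forall>x\<in>fst p. \<forall>y\<in>snd p. {x, y} \<notin> H}"
  have fin: "finite (double_box u v)" for u v by (simp add: double_box_def)
  have finI: "finite I" unfolding I_def using fin by auto
  have "?X \<subseteq> (\<Union>p\<in>I. ?N p)"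
  proof
    fix H assume "H \<in> ?X"
    then obtain u v A where "u \<in> V" "v \<in> V" "touch (box u) (box v)" "A \<subseteq> double_box u v"
      "a \<le> card A" "a \<le> card (double_box u v - A)" and H: "\<forall>x\<in>A. \<forall>y\<in>double_box u v - A. {x, y} \<notin> H"
      by blast
    then have "(A, double_box u v - A) \<in> I" unfolding I_def by blast
    then show "H \<in> (\<Union>p\<in>I. ?N p)" using H by fastforce
  qed
  then have "?P ?X \<le> ?P (\<Union>p\<in>I. ?N p)"
    by (intro measure_pmf.finite_measure_mono) auto
  also have "\<dots> \<le> (\<Sum>p\<in>I. ?P (?N p))"
    by (rule measure_pmf.finite_measure_subadditive_finite[OF finI]) auto
  also have "\<dots> \<le> (\<Sum>p\<in>I. exp (- real m * a\<^sup>2 / \<Delta>))"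
  proof (rule sum_mono)
    fix p assume "p \<in> I"
    then obtain u v A where *: "u \<in> V" "v \<in> V" "touch (box u) (box v)" "A \<subseteq> double_box u v"
      "a \<le> card A" "a \<le> card (double_box u v - A)" "p = (A, double_box u v - A)"
      unfolding I_def by blast
    have "double_box u v \<subseteq> V" by (auto simp: double_box_def)
    then have "measure_pmf.prob (irrigation_pmf n c E) {H. \<forall>x\<in>A. \<forall>y\<in>double_box u v - A. {x, y} \<notin> H}
      \<le> exp (- real m * a\<^sup>2 / \<Delta>)"
      using * by (intro prob_no_crossing_le a m double_box_edge[OF *(3)]) auto
    then show "?P (?N p) \<le> exp (- real m * a\<^sup>2 / \<Delta>)" using * by simp
  qed
  also have "\<dots> = real (card I) * exp (- real m * a\<^sup>2 / \<Delta>)" by simp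
  also have "\<dots> \<le> ((real n)\<^sup>2 * exp (8 * \<mu>)) * exp (- real m * a\<^sup>2 / \<Delta>)"
  proof (intro mult_right_mono)
    let ?J = "\<lambda>u v. (\<lambda>A. (A, double_box u v - A)) `
     {A. A \<subseteq> double_box u v \<and> touch (box u) (box v) \<and> a \<le> card A \<and> a \<le> card (double_box u v - A)}"
    have J: "real (card (?J u v)) \<le> exp (8 * \<mu>)" for u v
    proof -
      have "card (?J u v) \<le> card (Pow (double_box u v))"
        using fin[of u v] by (intro surj_card_le[where f = "\<lambda>A. (A, double_box u v - A)"]) auto
      then have "real (card (?J u v)) \<le> 2 ^ card (double_box u v)"
        using fin[of u v] by (simp add: card_Pow flip: of_nat_le_iff)
      also have "\<dots> \<le> exp 1 ^ card (double_box u v)"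
        using exp_ge_add_one_self[of 1] by (intro power_mono) auto
      also have "\<dots> = exp (card (double_box u v))" by (simp add: exp_of_nat_mult[symmetric])
      also have "\<dots> \<le> exp (8 * \<mu>)" using card_double_box_le by simp
      finally show ?thesis .
    qed
    have "card I \<le> (\<Sum>u\<in>V. \<Sum>v\<in>V. card (?J u v))"
      unfolding I_def by (intro order_trans[OF card_UN_le] sum_mono card_UN_le) auto
    then have "real (card I) \<le> (\<Sum>u\<in>V. \<Sum>v\<in>V. real (card (?J u v)))"
      by (simp flip: of_nat_sum)
    also have "\<dots> \<le> (\<Sum>u\<in>V. \<Sum>v\<in>V. exp (8 * \<mu>))" by (intro sum_mono J)
    also have "\<dots> = (real n)\<^sup>2 * exp (8 * \<mu>)" by (simp add: power2_eq_square)
    finally show "real (card I) \<le> (real n)\<^sup>2 * exp (8 * \<mu>)" .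
  qed simp
  finally show ?thesis .
qed

text \<open>Union bound over the connected sets of size \<open>k\<close>. A vertex of such a set has at most \<open>k\<close> neighbours in
  it, and at most \<open>C a\<close> by sparsity; the first bound decides near \<open>k = m + 1\<close>, the second for
  large \<open>k\<close>.\<close>
lemma prob_sparse_closed_le:
  fixes a :: real
  assumes a: "0 < a" and m: "m \<le> c" "real m \<le> \<mu> / 5"
  shows "measure_pmf.prob (irrigation_pmf n c E)
     {H. \<exists>T\<subseteq>V. m < card T \<and> connected_set E T \<and> sparse a T \<and> closed_in H T}
     \<le> (\<Sum>k = Suc m..n. real n * \<Delta> ^ (2 * k) * (min (real k / (\<mu> / 5)) (C * a / (\<mu> / 5))) ^ (m * k))"
    (is "measure_pmf.prob _ ?X \<le> (\<Sum>k = Suc m..n. ?f k)")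
proof -
  let ?P = "measure_pmf.prob (irrigation_pmf n c E)"
  define q where "q k = min (real k / (\<mu> / 5)) (C * a / (\<mu> / 5))" for k
  define I where "I k = {T. T \<subseteq> V \<and> connected_set E T \<and> card T = k \<and> sparse a T}" for k
  have finI: "finite (I k)" for k
    by (rule finite_subset[of _ "Pow V"]) (auto simp: I_def)
  have "?X \<subseteq> (\<Union>k\<in>{Suc m..n}. \<Union>T\<in>I k. {H. closed_in H T})"
  proof
    fix H assume "H \<in> ?X"
    then obtain T where T: "T \<subseteq> V" "m < card T" "connected_set E T" "sparse a T" "closed_in H T" by blast
    have "card T \<le> n" using card_mono[OF _ T(1)] by simp
    then have "card T \<in> {Suc m..n}" "T \<in> I (card T)" using T by (auto simp: I_def)
    then show "H \<in> (\<Union>k\<in>{Suc m..n}. \<Union>T\<in>I k. {H. closed_in H T})" using T(5) by blast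
  qed
  then have "?P ?X \<le> ?P (\<Union>k\<in>{Suc m..n}. \<Union>T\<in>I k. {H. closed_in H T})"
    by (intro measure_pmf.finite_measure_mono) auto
  also have "\<dots> \<le> (\<Sum>k = Suc m..n. ?P (\<Union>T\<in>I k. {H. closed_in H T}))"
    by (rule measure_pmf.finite_measure_subadditive_finite) auto
  also have "\<dots> \<le> (\<Sum>k = Suc m..n. ?f k)"
  proof (rule sum_mono)
    fix k assume k: "k \<in> {Suc m..n}"
    have q0: "0 \<le> q k" using a mu_ge by (simp add: q_def)
    have "?P (\<Union>T\<in>I k. {H. closed_in H T}) \<le> (\<Sum>T\<in>I k. ?P {H. closed_in H T})"
      by (rule measure_pmf.finite_measure_subadditive_finite[OF finI]) auto
    also have "\<dots> \<le> (\<Sum>T\<in>I k. q k ^ (m * k))"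
    proof (rule sum_mono)
      fix T assume T: "T \<in> I k"
      then have TV: "T \<subseteq> V" by (simp add: I_def)
      then have finT: "finite T" using finite_subset by blast
      have "?P {H. closed_in H T} \<le> q k ^ (m * card T)"
      proof (rule prob_closed_le[OF TV m])
        fix v assume "v \<in> T"
        have "card {w \<in> T. {v, w} \<in> E} \<le> card T" using finT by (intro card_mono) auto
        moreover have "real (card {w \<in> T. {v, w} \<in> E}) \<le> C * a"
        proof -
          have "card {w \<in> T. {v, w} \<in> E} \<le> card {w \<in> T. box w \<in> near (box v)}"
            using finT near_edge by (intro card_mono) auto
          also have "real (card {w \<in> T. box w \<in> near (box v)}) \<le> C * a"
            using T by (intro near_count TV) (auto simp: I_def sparse_def intro: less_imp_le)
          finally show ?thesis by simp
        qed
        ultimately show "real (card {w \<in> T. {v, w} \<in> E}) / (\<mu> / 5) \<le> q k"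
          using T mu_ge unfolding q_def I_def by (auto intro!: divide_right_mono)
      qed
      then show "?P {H. closed_in H T} \<le> q k ^ (m * k)" using T by (simp add: I_def)
    qed
    also have "\<dots> = real (card (I k)) * q k ^ (m * k)" by simp
    also have "\<dots> \<le> (real n * \<Delta> ^ (2 * k)) * q k ^ (m * k)"
    proof (intro mult_right_mono)
      have "card (I k) \<le> card {T. T \<subseteq> V \<and> connected_set E T \<and> card T = k}"
        by (rule card_mono) (auto simp: I_def)
      also have "\<dots> \<le> card V * nat \<lfloor>\<Delta>\<rfloor> ^ (2 * (k - 1))"
      proof (rule card_connected_sets_le)
        fix v
        show "card {w \<in> V. {v, w} \<in> E} \<le> nat \<lfloor>\<Delta>\<rfloor>"
          using deg_le[of v] unfolding nbrs_def by (simp add: le_nat_floor)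
      qed simp
      finally have "real (card (I k)) \<le> real n * real (nat \<lfloor>\<Delta>\<rfloor>) ^ (2 * (k - 1))"
        by (metis (no_types, lifting) card_atLeastAtMost diff_Suc_1 of_nat_le_iff of_nat_mult of_nat_power)
      also have "\<dots> \<le> real n * \<Delta> ^ (2 * (k - 1))"
        using Delta_ge by (intro mult_left_mono power_mono) auto
      also have "\<dots> \<le> real n * \<Delta> ^ (2 * k)"
        using Delta_ge by (intro mult_left_mono power_increasing) auto
      finally show "real (card (I k)) \<le> real n * \<Delta> ^ (2 * k)" .
    qed (use q0 in simp)
    finally show "?P (\<Union>T\<in>I k. {H. closed_in H T}) \<le> ?f k" by (simp add: q_def)
  qed
  finally show ?thesis .
qed

lemma prob_disconnected_le:
  fixes a :: real
  assumes a: "0 < a" "2 * a \<le> \<mu> / 4" and m: "m \<le> c" "real m \<le> \<mu> / 5"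
  shows "measure_pmf.prob (irrigation_pmf n c E) {H. \<not> graph_connected n H}
     \<le> (real n)\<^sup>2 * exp (8 * \<mu>) * exp (- real m * a\<^sup>2 / \<Delta>) +
       (\<Sum>k = Suc m..n. real n * \<Delta> ^ (2 * k) * (min (real k / (\<mu> / 5)) (C * a / (\<mu> / 5))) ^ (m * k))"
proof -
  let ?P = "measure_pmf.prob (irrigation_pmf n c E)"
  let ?X = "{H. \<exists>u\<in>V. \<exists>v\<in>V. touch (box u) (box v) \<and> (\<exists>A\<subseteq>double_box u v.
             a \<le> card A \<and> a \<le> card (double_box u v - A) \<and>
             (\<forall>x\<in>A. \<forall>y\<in>double_box u v - A. {x, y} \<notin> H))}"
  let ?Y = "{H. \<exists>T\<subseteq>V. m < card T \<and> connected_set E T \<and> sparse a T \<and> closed_in H T}"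
  have "?P {H. \<not> graph_connected n H} \<le> ?P (?X \<union> ?Y)"
  proof (rule measure_pmf.finite_measure_mono_AE)
    show "AE H in irrigation_pmf n c E. H \<in> {H. \<not> graph_connected n H} \<longrightarrow> H \<in> ?X \<union> ?Y"
      unfolding AE_measure_pmf_iff
    proof (intro ballI impI)
      fix H assume H: "H \<in> set_pmf (irrigation_pmf n c E)" "H \<in> {H. \<not> graph_connected n H}"
      have "m \<le> card {w. {v, w} \<in> H}" if "v \<in> V" for v
        using irrigation_support(2)[OF H(1) that] deg_ge[OF that] m by linarith
      then show "H \<in> ?X \<union> ?Y"
        using disconnected_cases[OF irrigation_support(1)[OF H(1)] _ _ a, of m] H(2) by blast
    qed
  qed simp
  also have "\<dots> \<le> ?P ?X + ?P ?Y"
    by (rule measure_Un_le) auto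
  also have "\<dots> \<le> (real n)\<^sup>2 * exp (8 * \<mu>) * exp (- real m * a\<^sup>2 / \<Delta>) +
       (\<Sum>k = Suc m..n. real n * \<Delta> ^ (2 * k) * (min (real k / (\<mu> / 5)) (C * a / (\<mu> / 5))) ^ (m * k))"
    using a m by (intro add_mono prob_split_le prob_sparse_closed_le) auto
  finally show ?thesis .
qed

end

section \<open>Isolated cliques\<close>

lemma not_graph_connectedI:
  assumes "closed_in H Q" "u \<in> Q" "u \<in> {1..n}" "v \<notin> Q" "v \<in> {1..n}"
  shows "\<not> graph_connected n H"
proof
  assume "graph_connected n H"
  then have "(u, v) \<in> {(a, b). {a, b} \<in> H}\<^sup>*" using assms by (simp add: graph_connected_def)
  then have "v \<in> Q"
    by (induction rule: rtrancl_induct) (use assms in \<open>auto dest: closed_inD\<close>)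
  then show False using assms by simp
qed

context boxed_graph
begin

text \<open>The vicinity of \<open>v\<close> contains all neighbours of all vertices in the box of \<open>v\<close>. Whether a subset of
  that box is isolated is decided by the picks in the vicinity alone.\<close>
definition vicinity :: "nat \<Rightarrow> nat set" where
  "vicinity v = {w \<in> V. box w \<in> near (box v)}"

lemma vicinity_sym: "u \<in> vicinity v \<Longrightarrow> v \<in> V \<Longrightarrow> v \<in> vicinity u"
  using near_sym by (auto simp: vicinity_def)

lemma card_vicinity_le: "card (vicinity v) \<le> \<Delta>"
  unfolding vicinity_def by (rule near_V_le)

lemma exists_separated_vertices:
  "\<exists>J \<subseteq> V. (\<forall>v\<in>J. \<forall>w\<in>J. v \<noteq> w \<longrightarrow> vicinity v \<inter> vicinity w = {}) \<and> real n / \<Delta>\<^sup>2 \<le> card J"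
proof -
  let ?R = "\<lambda>v w. vicinity v \<inter> vicinity w \<noteq> {}"
  have fin: "finite (vicinity v)" for v by (simp add: vicinity_def)
  have "\<exists>J \<subseteq> V. (\<forall>v\<in>J. \<forall>w\<in>J. v \<noteq> w \<longrightarrow> \<not> ?R v w) \<and> card V \<le> nat \<lfloor>\<Delta>\<^sup>2\<rfloor> * card J"
  proof (rule exists_large_separated_subset)
    show "?R v v" if "v \<in> V" for v using that near_refl[of "box v"] by (auto simp: vicinity_def)
    show "?R w v" if "?R v w" for v w using that by blast
    show "card {w \<in> V. ?R v w} \<le> nat \<lfloor>\<Delta>\<^sup>2\<rfloor>" if "v \<in> V" for v
    proof -
      have "{w \<in> V. ?R v w} \<subseteq> (\<Union>u\<in>vicinity v. vicinity u)"
        using vicinity_sym by blast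
      then have "card {w \<in> V. ?R v w} \<le> card (\<Union>u\<in>vicinity v. vicinity u)"
        using fin by (intro card_mono) auto
      also have "\<dots> \<le> (\<Sum>u\<in>vicinity v. card (vicinity u))" by (rule card_UN_le[OF fin])
      finally have "real (card {w \<in> V. ?R v w}) \<le> (\<Sum>u\<in>vicinity v. real (card (vicinity u)))"
        by (simp only: of_nat_sum[symmetric] of_nat_le_iff)
      also have "\<dots> \<le> (\<Sum>u\<in>vicinity v. \<Delta>)" by (intro sum_mono card_vicinity_le)
      also have "\<dots> = card (vicinity v) * \<Delta>" by simp
      also have "\<dots> \<le> \<Delta> * \<Delta>" using Delta_ge by (intro mult_right_mono card_vicinity_le) auto
      finally show ?thesis by (simp add: power2_eq_square le_nat_floor)
    qed
  qed simp
  then obtain J where J: "J \<subseteq> V" "\<forall>v\<in>J. \<forall>w\<in>J. v \<noteq> w \<longrightarrow> vicinity v \<inter> vicinity w = {}"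
    "card V \<le> nat \<lfloor>\<Delta>\<^sup>2\<rfloor> * card J" by blast
  have "real n \<le> real (nat \<lfloor>\<Delta>\<^sup>2\<rfloor>) * card J"
    using J(3) by (simp only: of_nat_mult[symmetric] of_nat_le_iff card_atLeastAtMost diff_Suc_1)
  also have "\<dots> \<le> \<Delta>\<^sup>2 * card J" by (intro mult_right_mono) auto
  finally have "real n / \<Delta>\<^sup>2 \<le> card J" using Delta_ge by (simp add: divide_le_eq mult.commute)
  then show ?thesis using J by blast
qed

text \<open>The picks at \<open>u\<close> that are compatible with \<open>Q\<close>, a set of \<open>c + 1\<close> vertices in the box of \<open>v\<close>, being an
  isolated clique: members pick exactly the other members, vertices of the vicinity
  pick no member, and far vertices are unrestricted.\<close>
definition isolating_picks :: "nat set \<Rightarrow> nat \<Rightarrow> nat \<Rightarrow> nat set set set" where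
  "isolating_picks Q v u =
     (if u \<in> Q then {(\<lambda>w. {u, w}) ` (Q - {u})}
      else if u \<in> vicinity v then {A. A \<subseteq> (\<lambda>w. {u, w}) ` (nbrs u - Q)}
      else UNIV)"

lemma closed_in_isolated:
  assumes Q: "Q \<subseteq> {w \<in> V. box w = box v}"
    and A: "\<And>u. u \<in> V \<Longrightarrow> A u \<in> set_pmf (picked_edges_pmf E c u)"
    and iso: "\<And>u. u \<in> V \<Longrightarrow> A u \<in> isolating_picks Q v u"
  shows "closed_in (\<Union>u\<in>V. A u) Q"
  unfolding closed_in_def
proof
  fix e assume "e \<in> (\<Union>u\<in>V. A u)"
  then obtain u where u: "u \<in> V" "e \<in> A u" by blast
  then obtain w where w: "e = {u, w}" "w \<in> nbrs u"
    using picked_support(1)[OF A[OF u(1)]] unfolding incident_eq by blast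
  consider "u \<in> Q" | "u \<notin> Q" "u \<in> vicinity v" | "u \<notin> vicinity v" by blast
  then show "e \<subseteq> Q \<or> e \<inter> Q = {}"
  proof cases
    case 1
    then have "e \<in> (\<lambda>w. {u, w}) ` (Q - {u})" using iso[OF u(1)] u(2) by (simp add: isolating_picks_def)
    then show ?thesis using 1 by blast
  next
    case 2
    then have "e \<in> (\<lambda>w. {u, w}) ` (nbrs u - Q)" using iso[OF u(1)] u(2) by (auto simp: isolating_picks_def)
    then show ?thesis using 2 by blast
  next
    case 3
    have "u \<notin> Q" using 3 Q near_refl by (auto simp: vicinity_def)
    moreover have "w \<notin> Q"
    proof
      assume "w \<in> Q"
      then have "box w = box v" using Q by blast
      moreover have "box u \<in> near (box w)"
        using w(2) near_edge[of w u] by (simp add: nbrs_def insert_commute)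
      ultimately show False using 3 u(1) by (simp add: vicinity_def)
    qed
    ultimately show ?thesis using w by blast
  qed
qed

text \<open>The \<open>c + 1\<close> members contribute the power of \<open>c / (e \<Delta>)\<close>. Each of the at most \<open>\<Delta>\<close> other vertices of the
  vicinity avoids the members with probability at least \<open>exp (- 20 c (c + 1) / \<mu>)\<close>; together they cost
  only \<open>exp (- O(c\<^sup>2))\<close>.\<close>
lemma isolating_picks_prob_ge:
  assumes v: "v \<in> V" and Q: "Q \<subseteq> {w \<in> V. box w = box v}" "card Q = c + 1" and c: "0 < c" "3 * real c + 2 \<le> \<mu> / 10"
  shows "(real c / (exp 1 * \<Delta>)) ^ (c * (c + 1)) * exp (- 80 * real C * (real c * (real c + 1)))
     \<le> (\<Prod>u\<in>V. measure_pmf.prob (picked_edges_pmf E c u) (isolating_picks Q v u))"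
proof -
  let ?p = "\<lambda>u. measure_pmf.prob (picked_edges_pmf E c u) (isolating_picks Q v u)"
  let ?N = "vicinity v"
  have QN: "Q \<subseteq> ?N" using Q near_refl by (auto simp: vicinity_def)
  have NV: "?N \<subseteq> V" by (auto simp: vicinity_def)
  have finN: "finite ?N" using NV finite_subset by blast
  have finQ: "finite Q" using QN finN finite_subset by blast
  let ?x = "20 * (real c * (real c + 1)) / \<mu>"
  have clique: "(\<lambda>w. {u, w}) ` (Q - {u}) \<subseteq> incident_edges E u" if "u \<in> Q" for u
  proof
    fix e assume "e \<in> (\<lambda>w. {u, w}) ` (Q - {u})"
    then obtain w where w: "e = {u, w}" "w \<in> Q" "w \<noteq> u" by blast
    have "u \<in> V" "w \<in> V" "box u = box v" "box w = box v" using Q(1) that w(2) by blast+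
    then show "e \<in> incident_edges E u"
      using touch_edge[of u w] touch_refl[of "box v"] w by (simp add: incident_edges_def)
  qed
  have inside: "(real c / (exp 1 * \<Delta>)) ^ c \<le> ?p u" if u: "u \<in> Q" for u
  proof -
    have "card ((\<lambda>w. {u, w}) ` (Q - {u})) = c"
      using u finQ Q(2) by (simp add: card_image[OF inj_edge])
    then show ?thesis
      using pick_exact_prob_ge[OF finite_E clique[OF u] _ c(1)] deg_le[of u] u
      by (simp add: isolating_picks_def card_incident)
  qed
  have outside: "exp (- ?x) \<le> ?p u" if u: "u \<in> ?N - Q" for u
  proof -
    have uV: "u \<in> V" using u NV by blast
    have deg: "\<mu> / 5 \<le> card (nbrs u)" by (rule deg_ge[OF uV])
    let ?q = "card (nbrs u \<inter> Q)" and ?F = "(\<lambda>w. {u, w}) ` (nbrs u - Q)"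
    have q: "?q \<le> c + 1" using card_mono[OF finQ, of "nbrs u \<inter> Q"] Q(2) by simp
    have "nbrs u = (nbrs u - Q) \<union> (nbrs u \<inter> Q)" by blast
    then have "card (nbrs u) = card (nbrs u - Q) + ?q"
      using card_Un_disjoint[of "nbrs u - Q" "nbrs u \<inter> Q"] nbrs_finite(1)[of u] by auto
    then have D: "card (incident_edges E u) = card ?F + ?q"
      unfolding card_incident card_image[OF inj_edge] .
    have "real c + 2 * real ?q \<le> real (card (nbrs u))" using q c deg mu_ge by linarith
    then have cD: "c + 2 * ?q \<le> card (incident_edges E u)" unfolding card_incident by linarith
    have "real c < real (card (nbrs u))" using c deg by linarith
    then have cD': "c < card (incident_edges E u)" unfolding card_incident by linarith
    have "?F \<subseteq> incident_edges E u" unfolding incident_eq by blast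
    from pick_subset_prob_ge[OF finite_E this D cD cD']
    have *: "exp (- 2 * real c * real ?q / (real (card (nbrs u)) - real c)) \<le> ?p u"
      using u by (simp add: isolating_picks_def card_incident)
    have "2 * real c * real ?q / (real (card (nbrs u)) - real c) \<le> 2 * real c * (real c + 1) / (\<mu> / 10)"
      using q c deg mu_ge by (intro frac_le mult_left_mono) auto
    also have "\<dots> = ?x" by simp
    finally have "exp (- ?x) \<le> exp (- 2 * real c * real ?q / (real (card (nbrs u)) - real c))"
      by simp
    then show ?thesis using * by linarith
  qed
  have far: "?p u = 1" if "u \<in> V - ?N" for u
    using that QN by (auto simp: isolating_picks_def measure_pmf.prob_space[unfolded space_measure_pmf])
  have x0: "0 \<le> ?x" using mu_ge by simp
  have "exp (- 80 * real C * (real c * (real c + 1))) = exp (- (\<Delta> * ?x))"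
    using mu_ge by (simp add: \<Delta>_def)
  also have "\<dots> \<le> exp (- (real (card (?N - Q)) * ?x))"
  proof -
    have "real (card (?N - Q)) \<le> \<Delta>"
      using card_mono[OF finN, of "?N - Q"] card_vicinity_le[of v] by fastforce
    then show ?thesis
      unfolding exp_le_cancel_iff neg_le_iff_le by (intro mult_right_mono x0)
  qed
  also have "\<dots> = (\<Prod>u\<in>?N - Q. exp (- ?x))"
    by (simp add: exp_of_nat_mult[symmetric])
  also have "\<dots> \<le> (\<Prod>u\<in>?N - Q. ?p u)"
    using outside by (intro prod_mono) auto
  finally have out: "exp (- 80 * real C * (real c * (real c + 1))) \<le> (\<Prod>u\<in>?N - Q. ?p u)" .
  have "(real c / (exp 1 * \<Delta>)) ^ (c * (c + 1)) = (\<Prod>u\<in>Q. (real c / (exp 1 * \<Delta>)) ^ c)"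
    by (simp only: prod_constant Q(2) power_mult)
  also have "\<dots> \<le> (\<Prod>u\<in>Q. ?p u)"
    using inside Delta_ge by (intro prod_mono) auto
  finally have "(real c / (exp 1 * \<Delta>)) ^ (c * (c + 1)) * exp (- 80 * real C * (real c * (real c + 1)))
      \<le> (\<Prod>u\<in>Q. ?p u) * (\<Prod>u\<in>?N - Q. ?p u)"
    by (intro mult_mono out prod_nonneg) auto
  also have "\<dots> = (\<Prod>u\<in>?N. ?p u)"
    using prod.subset_diff[OF QN finN, of ?p] by (simp add: mult.commute)
  also have "\<dots> = (\<Prod>u\<in>V. ?p u)"
    using NV far by (intro prod.mono_neutral_left) auto
  finally show ?thesis .
qed

text \<open>An isolated clique is a closed set, and it is not everything because it has fewer vertices than some
  vertex has neighbours. For vertices with disjoint vicinities the isolation events are independent,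
  so if each has probability at least \<open>p\<close>, all of them fail with probability at most
  \<open>(1 - p)\<^bsup>n / \<Delta>\<^sup>2\<^esup> \<le> exp (- p n / \<Delta>\<^sup>2)\<close>.\<close>
lemma prob_connected_le:
  assumes c: "0 < c" "3 * real c + 2 \<le> \<mu> / 10"
  shows "measure_pmf.prob (irrigation_pmf n c E) {H. graph_connected n H}
    \<le> exp (- (real n / \<Delta>\<^sup>2 * ((real c / (exp 1 * \<Delta>)) ^ (c * (c + 1)) *
          exp (- 80 * real C * (real c * (real c + 1))))))"
    (is "_ \<le> exp (- (_ * ?p))")
proof -
  let ?M = "Pi_pmf V {} (picked_edges_pmf E c)"
  have "\<exists>Q. Q \<subseteq> {w \<in> V. box w = box v} \<and> card Q = c + 1" if "v \<in> V" for v
  proof -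
    have "real (c + 1) \<le> card {w \<in> V. box w = box v}" using box_ge[OF that] c by simp
    then have "c + 1 \<le> card {w \<in> V. box w = box v}" by linarith
    then show ?thesis by (meson obtain_subset_with_card_n)
  qed
  then obtain Q where Q: "\<And>v. v \<in> V \<Longrightarrow> Q v \<subseteq> {w \<in> V. box w = box v} \<and> card (Q v) = c + 1"
    by metis
  define S where "S v = isolating_picks (Q v) v" for v
  define I where "I v = Pi V (S v)" for v
  obtain J where J: "J \<subseteq> V" "\<forall>v\<in>J. \<forall>w\<in>J. v \<noteq> w \<longrightarrow> vicinity v \<inter> vicinity w = {}"
    "real n / \<Delta>\<^sup>2 \<le> card J" using exists_separated_vertices by blast
  have finJ: "finite J" using J(1) finite_subset by blast
  have prob_I: "measure_pmf.prob ?M (I v) = (\<Prod>u\<in>V. measure_pmf.prob (picked_edges_pmf E c u) (S v u))" for v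
    unfolding I_def by (rule measure_Pi_pmf_Pi) simp
  have I_ge: "?p \<le> measure_pmf.prob ?M (I v)" if "v \<in> J" for v
  proof -
    have "v \<in> V" using J(1) that by blast
    then show ?thesis
      unfolding prob_I S_def using Q[of v] c by (intro isolating_picks_prob_ge) blast+
  qed
  have S_UNIV: "S v u = UNIV" if "v \<in> J" "u \<notin> vicinity v" for v u
  proof -
    have "Q v \<subseteq> vicinity v" using Q[of v] J(1) that near_refl by (fastforce simp: vicinity_def)
    then show ?thesis using that by (auto simp: S_def isolating_picks_def)
  qed
  have indep: "measure_pmf.prob ?M {A. \<forall>v\<in>K. A \<in> I v} = (\<Prod>v\<in>K. measure_pmf.prob ?M (I v))"
    if K: "K \<subseteq> J" for K
  proof -
    have finK: "finite K" using K finJ finite_subset by blast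
    \<comment> \<open>At most one of the events constrains the pick at \<open>u\<close>.\<close>
    have one: "measure_pmf.prob (picked_edges_pmf E c u) (\<Inter>v\<in>K. S v u) =
        (\<Prod>v\<in>K. measure_pmf.prob (picked_edges_pmf E c u) (S v u))" for u
    proof (cases "\<exists>v\<in>K. u \<in> vicinity v")
      case True
      then obtain v where v: "v \<in> K" "u \<in> vicinity v" by blast
      have other: "S w u = UNIV" if "w \<in> K - {v}" for w
        using that v K J(2) by (intro S_UNIV) auto
      have "(\<Inter>w\<in>K. S w u) = S v u" using v(1) other by blast
      moreover have "(\<Prod>w\<in>K. measure_pmf.prob (picked_edges_pmf E c u) (S w u)) =
          measure_pmf.prob (picked_edges_pmf E c u) (S v u)"
        using other by (simp add: prod.remove[OF finK v(1)] measure_pmf.prob_space[unfolded space_measure_pmf])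
      ultimately show ?thesis by simp
    next
      case False
      then have "S w u = UNIV" if "w \<in> K" for w using that K by (intro S_UNIV) auto
      then show ?thesis by (simp add: measure_pmf.prob_space[unfolded space_measure_pmf])
    qed
    have "{A. \<forall>v\<in>K. A \<in> I v} = Pi V (\<lambda>u. \<Inter>v\<in>K. S v u)" by (auto simp: I_def)
    then have "measure_pmf.prob ?M {A. \<forall>v\<in>K. A \<in> I v} =
        (\<Prod>u\<in>V. measure_pmf.prob (picked_edges_pmf E c u) (\<Inter>v\<in>K. S v u))"
      by (simp add: measure_Pi_pmf_Pi)
    also have "\<dots> = (\<Prod>v\<in>K. \<Prod>u\<in>V. measure_pmf.prob (picked_edges_pmf E c u) (S v u))"
      unfolding one by (rule prod.swap)
    finally show ?thesis unfolding prob_I .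
  qed
  have "measure_pmf.prob (irrigation_pmf n c E) {H. graph_connected n H}
      = measure_pmf.prob ?M ((\<lambda>A. \<Union>v\<in>V. A v) -` {H. graph_connected n H})"
    unfolding irrigation_pmf_def by simp
  also have "\<dots> \<le> measure_pmf.prob ?M {A. \<forall>v\<in>J. A \<notin> I v}"
  proof (rule measure_pmf.finite_measure_mono_AE)
    show "AE A in ?M. A \<in> (\<lambda>A. \<Union>v\<in>V. A v) -` {H. graph_connected n H} \<longrightarrow> A \<in> {A. \<forall>v\<in>J. A \<notin> I v}"
      unfolding AE_measure_pmf_iff
    proof (intro ballI impI CollectI notI)
      fix A v assume A: "A \<in> set_pmf ?M" "A \<in> (\<lambda>A. \<Union>v\<in>V. A v) -` {H. graph_connected n H}"
        and v: "v \<in> J" and AI: "A \<in> I v"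
      have vV: "v \<in> V" using v J(1) by blast
      have "closed_in (\<Union>u\<in>V. A u) (Q v)"
        using A(1) AI Q[OF vV]
        by (intro closed_in_isolated[of _ v _ c]) (auto simp: set_Pi_pmf PiE_dflt_def I_def S_def)
      moreover have "Q v \<subseteq> V" "Q v \<noteq> {}" using Q[OF vV] by auto
      moreover have "Q v \<noteq> V"
      proof
        assume "Q v = V"
        then have "n = c + 1" using Q[OF vV] by simp
        moreover have "card (nbrs v) \<le> n" using card_mono[OF _ nbrs_finite(2), of v] by simp
        ultimately show False using deg_ge[OF vV] c by linarith
      qed
      ultimately have "\<not> graph_connected n (\<Union>u\<in>V. A u)"
        using not_graph_connectedI[of "\<Union>u\<in>V. A u" "Q v"] by blast
      then show False using A(2) by simp
    qed
  qed simp
  also have "\<dots> = (\<Prod>v\<in>J. 1 - measure_pmf.prob ?M (I v))"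
    by (rule prob_no_event_eq_prod[OF finJ indep])
  also have "\<dots> \<le> (\<Prod>v\<in>J. exp (- ?p))"
  proof (intro prod_mono conjI)
    fix v assume "v \<in> J"
    have "1 - measure_pmf.prob ?M (I v) \<le> 1 - ?p" using I_ge[OF \<open>v \<in> J\<close>] by simp
    also have "\<dots> \<le> exp (- ?p)" using exp_ge_add_one_self[of "- ?p"] by simp
    finally show "1 - measure_pmf.prob ?M (I v) \<le> exp (- ?p)" .
  qed simp
  also have "\<dots> = exp (- (card J * ?p))" by (simp add: exp_of_nat_mult[symmetric])
  also have "\<dots> \<le> exp (- (real n / \<Delta>\<^sup>2 * ?p))"
    unfolding exp_le_cancel_iff neg_le_iff_le
    by (intro mult_right_mono J(3)) (use Delta_ge in auto)
  finally show ?thesis .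
qed

end

section \<open>Concentration of the number of points in a cell\<close>

lemma exp_count_integral:
  assumes Q: "prob_space Q" and B: "B \<in> sets Q" and I: "finite I"
  shows "integrable (PiM I (\<lambda>_. Q)) (\<lambda>x. exp (s * real (card {i \<in> I. x i \<in> B})))" (is ?int)
    and "(\<integral>x. exp (s * real (card {i \<in> I. x i \<in> B})) \<partial>PiM I (\<lambda>_. Q))
       \<le> exp (real (card I) * measure Q B * (exp s - 1))" (is ?le)
proof -
  interpret Q: prob_space Q by (rule Q)
  interpret product_sigma_finite "\<lambda>_. Q" by unfold_locales
  define g :: "'a \<Rightarrow> real" where "g = (\<lambda>x. 1 + (exp s - 1) * indicator B x)"
  have "integrable Q (indicator B :: 'a \<Rightarrow> real)"
    using B by (intro integrable_real_indicator) (auto simp: less_top[symmetric])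
  then have g: "integrable Q g" "integral\<^sup>L Q g = 1 + (exp s - 1) * measure Q B"
    using B by (auto simp: g_def Q.prob_space)
  have eq: "exp (s * real (card {i \<in> I. x i \<in> B})) = (\<Prod>i\<in>I. g (x i))" for x :: "'b \<Rightarrow> 'a"
  proof -
    have "(\<Prod>i\<in>I. g (x i)) = (\<Prod>i\<in>I. if x i \<in> B then exp s else 1)"
      by (intro prod.cong) (auto simp: g_def)
    also have "\<dots> = exp s ^ card {i \<in> I. x i \<in> B}"
      using I by (simp add: prod.If_cases Int_def)
    finally show ?thesis by (simp add: exp_of_nat_mult[symmetric] mult.commute)
  qed
  show ?int unfolding eq using I g(1) by (intro product_integrable_prod) auto
  have "(\<integral>x. (\<Prod>i\<in>I. g (x i)) \<partial>PiM I (\<lambda>_. Q)) = (\<Prod>i\<in>I. integral\<^sup>L Q g)"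
    using I g(1) by (intro product_integral_prod) auto
  also have "\<dots> = (1 + (exp s - 1) * measure Q B) ^ card I" by (simp add: g)
  also have "\<dots> \<le> exp ((exp s - 1) * measure Q B) ^ card I"
  proof (rule power_mono)
    show "0 \<le> 1 + (exp s - 1) * measure Q B"
    proof -
      have "0 \<le> (1 - measure Q B) + exp s * measure Q B" by (intro add_nonneg_nonneg) auto
      then show ?thesis by (simp add: algebra_simps)
    qed
  qed (rule exp_ge_add_one_self)
  also have "\<dots> = exp (real (card I) * measure Q B * (exp s - 1))"
    by (simp add: exp_of_nat_mult[symmetric] algebra_simps)
  finally show ?le unfolding eq .
qed

text \<open>Markov's inequality for \<open>exp N\<close> and \<open>exp (- N)\<close>, where \<open>N\<close> is the number of points in \<open>B\<close>.\<close>
lemma count_concentration: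
  assumes Q: "prob_space Q" and B: "B \<in> sets Q" and I: "finite I"
    and \<mu>: "\<mu> = real (card I) * measure Q B"
  defines "P \<equiv> PiM I (\<lambda>_. Q)"
  defines "bad \<equiv> {x \<in> space P. real (card {i \<in> I. x i \<in> B}) \<le> \<mu> / 4} \<union>
      {x \<in> space P. 4 * \<mu> \<le> real (card {i \<in> I. x i \<in> B})}"
  shows "bad \<in> sets P" "measure P bad \<le> 2 * exp (- \<mu> / 4)"
proof -
  interpret Q: prob_space Q by (rule Q)
  interpret P: prob_space P unfolding P_def by (rule prob_space_PiM) (rule Q)
  let ?N = "\<lambda>x. real (card {i \<in> I. x i \<in> B})"
  have \<mu>0: "0 \<le> \<mu>" unfolding \<mu> by simp
  have N: "?N x = (\<Sum>i\<in>I. indicator B (x i))" for x :: "'b \<Rightarrow> 'a"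
    using I by (simp add: indicator_def sum.If_cases Int_def)
  have meas: "?N \<in> borel_measurable P"
    unfolding N P_def using B by measurable
  then show "bad \<in> sets P" unfolding bad_def by measurable
  have int: "integrable P (\<lambda>x. exp (s * ?N x))"
    and le: "(\<integral>x. exp (s * ?N x) \<partial>P) \<le> exp (\<mu> * (exp s - 1))" for s
    using exp_count_integral[OF Q B I, of s] by (auto simp: P_def \<mu>)
  have tail: "measure P {x \<in> space P. t \<le> s * ?N x} \<le> exp (\<mu> * (exp s - 1) - t)" for s t
  proof -
    have "measure P {x \<in> space P. exp t \<le> exp (s * ?N x)} \<le> (\<integral>x. exp (s * ?N x) \<partial>P) / exp t"
      by (rule integral_Markov_inequality_measure[OF int, of "{}"]) auto
    also have "\<dots> \<le> exp (\<mu> * (exp s - 1)) / exp t"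
      by (intro divide_right_mono le) auto
    finally show ?thesis by (simp add: exp_diff)
  qed
  have low: "measure P {x \<in> space P. ?N x \<le> \<mu> / 4} \<le> exp (- \<mu> / 4)"
  proof -
    have "{x \<in> space P. ?N x \<le> \<mu> / 4} = {x \<in> space P. - \<mu> / 4 \<le> (-1) * ?N x}" by auto
    then have "measure P {x \<in> space P. ?N x \<le> \<mu> / 4} \<le> exp (\<mu> * (exp (-1) - 1) - (- \<mu> / 4))"
      using tail[of "- \<mu> / 4" "-1"] by (simp only:)
    also have "\<dots> \<le> exp (- \<mu> / 4)"
    proof -
      have "exp (-1 :: real) \<le> 1/2"
        using exp_ge_add_one_self[of "1 :: real"] by (simp add: exp_minus field_simps)
      then have "\<mu> * (exp (-1) - 1) \<le> \<mu> * (- 1/2)" using \<mu>0 by (intro mult_left_mono) auto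
      then show ?thesis by simp
    qed
    finally show ?thesis .
  qed
  have high: "measure P {x \<in> space P. 4 * \<mu> \<le> ?N x} \<le> exp (- \<mu> / 4)"
  proof -
    have "measure P {x \<in> space P. 4 * \<mu> \<le> ?N x} \<le> exp (\<mu> * (exp 1 - 1) - 4 * \<mu>)"
      using tail[of "4 * \<mu>" 1] by simp
    also have "\<dots> \<le> exp (- \<mu> / 4)"
    proof -
      have "\<mu> * (exp 1 - 1) \<le> \<mu> * 2" using \<mu>0 exp_le by (intro mult_left_mono) auto
      then show ?thesis using \<mu>0 by simp
    qed
    finally show ?thesis .
  qed
  have "measure P bad \<le> measure P {x \<in> space P. ?N x \<le> \<mu> / 4} + measure P {x \<in> space P. 4 * \<mu> \<le> ?N x}"
    unfolding bad_def
    by (intro measure_Un_le borel_measurable_le meas borel_measurable_const)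
  then show "measure P bad \<le> 2 * exp (- \<mu> / 4)" using low high by linarith
qed

section \<open>Cells of the unit cube\<close>

text \<open>The minimum puts the points with a coordinate equal to \<open>1\<close> into the last cell, so that every point of
  the closed cube lies in one of the \<open>M\<^sup>d\<close> cells.\<close>
definition cell :: "nat \<Rightarrow> real ^ 'd \<Rightarrow> 'd \<Rightarrow> int" where
  "cell M x i = min (int M - 1) \<lfloor>real M * x $ i\<rfloor>"

definition cells :: "nat \<Rightarrow> ('d \<Rightarrow> int) set" where
  "cells M = {k. \<forall>i. 0 \<le> k i \<and> k i < int M}"

lemma unit_cube_iff: "x \<in> cbox 0 (1 :: real ^ 'd) \<longleftrightarrow> (\<forall>i. 0 \<le> x $ i \<and> x $ i \<le> 1)"
  by (auto simp: interval_cbox_cart[symmetric] less_eq_vec_def)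

lemma cell_bounds:
  assumes "x \<in> cbox 0 (1 :: real ^ 'd)" "0 < M"
  shows "0 \<le> cell M x i" "cell M x i < int M" "real_of_int (cell M x i) \<le> real M * x $ i"
    "real M * x $ i \<le> real_of_int (cell M x i) + 1"
proof -
  have x: "0 \<le> x $ i" "x $ i \<le> 1" using assms by (auto simp: unit_cube_iff)
  have Mx: "0 \<le> real M * x $ i" "real M * x $ i \<le> real M"
    using x by (auto simp: mult_left_le)
  show "0 \<le> cell M x i" "cell M x i < int M" using Mx assms by (auto simp: cell_def)
  have "real_of_int \<lfloor>real M * x $ i\<rfloor> \<le> real M * x $ i" "real M * x $ i < real_of_int \<lfloor>real M * x $ i\<rfloor> + 1"
    by linarith+
  then show "real_of_int (cell M x i) \<le> real M * x $ i"
    "real M * x $ i \<le> real_of_int (cell M x i) + 1"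
    using Mx by (auto simp: cell_def min_def le_floor_iff)
qed

lemma cell_in_cells:
  assumes "x \<in> cbox 0 (1 :: real ^ 'd)" "0 < M"
  shows "cell M x \<in> cells M"
  using cell_bounds[OF assms] by (simp add: cells_def)

lemma cells_eq_PiE: "(cells M :: ('d \<Rightarrow> int) set) = PiE UNIV (\<lambda>_. {0..<int M})"
  by (auto simp: cells_def PiE_def)

lemma finite_cells: "finite (cells M :: ('d::finite \<Rightarrow> int) set)"
  unfolding cells_eq_PiE by (intro finite_PiE) auto

lemma card_cells: "card (cells M :: ('d::finite \<Rightarrow> int) set) = M ^ CARD('d)"
  unfolding cells_eq_PiE by (simp add: card_PiE)

lemma cell_sets: "{x. cell M x = k} \<in> sets (borel :: (real ^ 'd) measure)"
proof -
  have "{x :: real ^ 'd. cell M x = k} = (\<Inter>i. {x. min (int M - 1) \<lfloor>real M * x $ i\<rfloor> = k i})"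
    by (auto simp: cell_def fun_eq_iff)
  moreover have "{x :: real ^ 'd. min (int M - 1) \<lfloor>real M * x $ i\<rfloor> = k i} \<in> sets borel" for i
    by measurable
  ultimately show ?thesis by auto
qed

abbreviation uniform_point :: "(real ^ 'd) measure" where
  "uniform_point \<equiv> uniform_measure lborel (cbox 0 1)"

lemma emeasure_unit_cube: "emeasure lborel (cbox 0 (1 :: real ^ 'd)) = 1"
proof -
  have one: "1 \<bullet> b = 1" if "b \<in> Basis" for b :: "real ^ 'd"
    using that by (auto simp: Basis_vec_def inner_axis)
  then show ?thesis using emeasure_lborel_cbox_eq[of "0 :: real ^ 'd" 1] by simp
qed

lemma prob_space_uniform_point: "prob_space (uniform_point :: (real ^ 'd) measure)"
  by (intro prob_space_uniform_measure) (auto simp: emeasure_unit_cube)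

lemma emeasure_lborel_cart_cbox_box:
  fixes a b :: "real ^ 'd"
  assumes "\<And>i. a $ i \<le> b $ i"
  shows "emeasure lborel (cbox a b) = ennreal (\<Prod>i\<in>UNIV. b $ i - a $ i)"
    "emeasure lborel (box a b) = ennreal (\<Prod>i\<in>UNIV. b $ i - a $ i)"
proof -
  have inj: "inj (\<lambda>i :: 'd. axis i (1 :: real))" by (auto simp: inj_on_def axis_eq_axis)
  have Basis: "(Basis :: (real ^ 'd) set) = range (\<lambda>i. axis i 1)" by (auto simp: Basis_vec_def)
  have "(\<Prod>v\<in>Basis. (b - a) \<bullet> v) = (\<Prod>i\<in>UNIV. b $ i - a $ i)"
    unfolding Basis by (subst prod.reindex[OF inj]) (simp add: inner_axis)
  moreover have "\<forall>v\<in>Basis. a \<bullet> v \<le> b \<bullet> v"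
    unfolding Basis using assms by (auto simp: inner_axis)
  ultimately show "emeasure lborel (cbox a b) = ennreal (\<Prod>i\<in>UNIV. b $ i - a $ i)"
    "emeasure lborel (box a b) = ennreal (\<Prod>i\<in>UNIV. b $ i - a $ i)"
    by (auto simp: emeasure_lborel_cbox_eq emeasure_lborel_box_eq)
qed

text \<open>Up to its boundary, a cell is a cube of side \<open>1 / M\<close>; squeezing it between the open and the closed cube
  avoids a discussion of which faces belong to it.\<close>
lemma measure_cell:
  fixes k :: "'d::finite \<Rightarrow> int"
  assumes k: "k \<in> cells M" and M: "0 < M"
  shows "measure uniform_point {x :: real ^ 'd. cell M x = k} = 1 / real M ^ CARD('d)"
proof -
  define a :: "real ^ 'd" where "a = (\<chi> i. real_of_int (k i) / M)"
  define b :: "real ^ 'd" where "b = (\<chi> i. (real_of_int (k i) + 1) / M)"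
  let ?K = "{x :: real ^ 'd. cell M x = k}"
  have ab: "a $ i \<le> b $ i" for i using M by (simp add: a_def b_def divide_right_mono)
  have prod: "(\<Prod>i\<in>UNIV. b $ i - a $ i) = 1 / real M ^ CARD('d)"
    by (simp add: a_def b_def diff_divide_distrib[symmetric] power_one_over)
  have kM: "0 \<le> k i" "k i < int M" for i using k by (auto simp: cells_def)
  have sub1: "box a b \<subseteq> cbox 0 1 \<inter> ?K"
  proof
    fix x assume "x \<in> box a b"
    then have x: "a $ i < x $ i" "x $ i < b $ i" for i by (auto simp: mem_box_cart)
    have kx: "real_of_int (k i) < real M * x $ i" "real M * x $ i < real_of_int (k i) + 1" for i
      using x[of i] M by (auto simp: a_def b_def field_simps)
    have kM1: "real_of_int (k i) + 1 \<le> real M" for i using kM(2)[of i] by linarith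
    have "0 < x $ i \<and> x $ i < 1" for i
    proof -
      have "0 < real M * x $ i" using kx(1)[of i] kM(1)[of i] by linarith
      moreover have "real M * x $ i < real M * 1" using kx(2)[of i] kM1[of i] by linarith
      ultimately show ?thesis using M by (simp add: zero_less_mult_iff mult_less_cancel_left_pos del: mult_1_right)
    qed
    then have "x \<in> cbox 0 1" by (simp add: unit_cube_iff less_imp_le)
    moreover have "cell M x i = k i" for i
    proof -
      have "\<lfloor>real M * x $ i\<rfloor> = k i" using kx[of i] by linarith
      then show ?thesis using kM(2)[of i] by (simp add: cell_def)
    qed
    ultimately show "x \<in> cbox 0 1 \<inter> ?K" by auto
  qed
  have sub2: "cbox 0 1 \<inter> ?K \<subseteq> cbox a b"
  proof
    fix x assume x: "x \<in> cbox 0 1 \<inter> ?K"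
    have "a $ i \<le> x $ i \<and> x $ i \<le> b $ i" for i
      using cell_bounds(3,4)[of x M i] x M by (auto simp: a_def b_def field_simps)
    then show "x \<in> cbox a b" by (simp add: mem_box_cart)
  qed
  have K: "cbox 0 1 \<inter> ?K \<in> sets lborel" using cell_sets[of M k] by auto
  have "emeasure lborel (box a b) \<le> emeasure lborel (cbox 0 1 \<inter> ?K)"
    by (rule emeasure_mono[OF sub1 K])
  moreover have "emeasure lborel (cbox 0 1 \<inter> ?K) \<le> emeasure lborel (cbox a b)"
    by (rule emeasure_mono[OF sub2]) auto
  ultimately have "emeasure lborel (cbox 0 1 \<inter> ?K) = ennreal (1 / real M ^ CARD('d))"
    using emeasure_lborel_cart_cbox_box[OF ab] prod by (metis antisym)
  then have "measure lborel (cbox 0 1 \<inter> ?K) = 1 / real M ^ CARD('d)" by (simp add: measure_def)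
  moreover have "measure lborel (cbox 0 (1 :: real ^ 'd)) = 1"
    using emeasure_unit_cube by (simp add: measure_def)
  ultimately show ?thesis
    using measure_uniform_measure[of lborel "cbox 0 1" ?K] cell_sets[of M k] by (simp add: emeasure_unit_cube)
qed

definition touching :: "('d \<Rightarrow> int) \<Rightarrow> ('d \<Rightarrow> int) \<Rightarrow> bool" where
  "touching k l \<longleftrightarrow> (\<forall>i. \<bar>k i - l i\<bar> \<le> 1)"

definition nearby :: "nat \<Rightarrow> ('d \<Rightarrow> int) \<Rightarrow> ('d \<Rightarrow> int) set" where
  "nearby R k = {l. \<forall>i. \<bar>k i - l i\<bar> \<le> int R}"

lemma nearby_eq_PiE: "nearby R k = PiE UNIV (\<lambda>i. {k i - int R..k i + int R})"
proof -
  have "\<bar>k i - l i\<bar> \<le> int R \<longleftrightarrow> k i - int R \<le> l i \<and> l i \<le> k i + int R" for l i by linarith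
  then show ?thesis by (auto simp: nearby_def PiE_def)
qed

definition balanced :: "nat \<Rightarrow> nat \<Rightarrow> real \<Rightarrow> (nat \<Rightarrow> real ^ 'd) \<Rightarrow> bool" where
  "balanced n M \<mu> x \<longleftrightarrow> (\<forall>i\<in>{1..n}. x i \<in> cbox 0 1) \<and>
     (\<forall>k\<in>cells M. \<mu> / 4 < real (card {i \<in> {1..n}. cell M (x i) = k}) \<and>
       real (card {i \<in> {1..n}. cell M (x i) = k}) < 4 * \<mu>)"

lemma balanced_prob:
  fixes n M :: nat
  assumes M: "0 < M"
  defines "\<mu> \<equiv> real n / real M ^ CARD('d)"
  defines "P \<equiv> (uniform_points n :: (nat \<Rightarrow> real ^ 'd) measure)"
  shows "\<exists>G \<in> sets P. (\<forall>x\<in>G. balanced n M \<mu> x) \<and>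
     1 - 2 * real M ^ CARD('d) * exp (- \<mu> / 4) \<le> measure P G"
proof -
  interpret P: prob_space P unfolding P_def by (rule prob_space_uniform_points)
  let ?I = "{1..n}"
  define bad where "bad k = {x \<in> space P. real (card {i \<in> ?I. x i \<in> {y. cell M y = k}}) \<le> \<mu> / 4} \<union>
      {x \<in> space P. 4 * \<mu> \<le> real (card {i \<in> ?I. x i \<in> {y. cell M y = k}})}" for k
  have bad: "bad k \<in> sets P" "measure P (bad k) \<le> 2 * exp (- \<mu> / 4)" if "k \<in> cells M" for k :: "'d \<Rightarrow> int"
  proof -
    have 1: "{y :: real ^ 'd. cell M y = k} \<in> sets uniform_point" using cell_sets[of M k] by simp
    have 2: "\<mu> = real (card ?I) * measure uniform_point {y :: real ^ 'd. cell M y = k}"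
      by (simp add: measure_cell[OF that M] \<mu>_def)
    note conc = count_concentration[OF prob_space_uniform_point 1 finite_atLeastAtMost 2,
        folded uniform_points_def, folded P_def]
    show "bad k \<in> sets P" "measure P (bad k) \<le> 2 * exp (- \<mu> / 4)"
      unfolding bad_def by (rule conc)+
  qed
  define U where "U = (\<Union>k\<in>cells M. bad k)"
  have U: "U \<in> sets P" unfolding U_def by (intro sets.finite_UN finite_cells bad(1))
  have "measure P U \<le> (\<Sum>k\<in>cells M. measure P (bad k))"
    unfolding U_def by (intro measure_UNION_le finite_cells bad(1))
  also have "\<dots> \<le> (\<Sum>k\<in>(cells M :: ('d \<Rightarrow> int) set). 2 * exp (- \<mu> / 4))"
    using bad(2) by (intro sum_mono)
  also have "\<dots> = 2 * real M ^ CARD('d) * exp (- \<mu> / 4)" by (simp add: card_cells)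
  finally have PU: "measure P U \<le> 2 * real M ^ CARD('d) * exp (- \<mu> / 4)" .
  define A where "A = {x \<in> space P. \<forall>i\<in>?I. x i \<in> cbox 0 1}"
  have A: "A \<in> sets P"
    unfolding A_def
  proof (intro sets.sets_Collect_finite_All)
    fix i assume i: "i \<in> ?I"
    have "(\<lambda>x. x i) \<in> measurable P (uniform_point :: (real ^ 'd) measure)"
      unfolding P_def uniform_points_def by (rule measurable_component_singleton[OF i])
    from measurable_sets[OF this, of "cbox 0 1"]
    show "{x \<in> space P. x i \<in> cbox 0 1} \<in> sets P" by (simp add: vimage_def Int_def conj_commute)
  qed simp
  have "AE x in P. \<forall>i\<in>?I. x i \<in> cbox 0 1"
  proof (intro AE_finite_allI)
    fix i assume i: "i \<in> ?I"
    have "AE y in uniform_point. y \<in> cbox 0 (1 :: real ^ 'd)" by (rule AE_uniform_measureI) auto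
    then show "AE x in P. x i \<in> cbox 0 1"
      unfolding P_def uniform_points_def by (intro AE_PiM_component[OF _ i] prob_space_uniform_point)
  qed simp
  then have PA: "AE x in P. x \<in> A" by (simp add: A_def)
  have "measure P (A - U) = measure P (space P - U)"
    using PA A U sets.sets_into_space[OF A] by (intro measure_eq_AE) auto
  also have "\<dots> = 1 - measure P U" using U by (rule P.prob_compl)
  finally have "1 - 2 * real M ^ CARD('d) * exp (- \<mu> / 4) \<le> measure P (A - U)" using PU by linarith
  moreover have "balanced n M \<mu> x" if "x \<in> A - U" for x
    using that unfolding balanced_def A_def U_def bad_def by (auto simp: not_le)
  ultimately show ?thesis using A U by (intro bexI[of _ "A - U"]) auto
qed

text \<open>Points in touching cells differ by at most \<open>2 / M\<close> in each coordinate, hence by at most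
  \<open>2 d / M < r\<close> in norm. Conversely, at distance below \<open>r\<close> the scaled coordinates differ by less
  than \<open>r M \<le> 3 d\<close>, and the indices of the cells by at most \<open>3 d + 1\<close>.\<close>
lemma balanced_boxed_graph:
  fixes x :: "nat \<Rightarrow> real ^ 'd"
  assumes bal: "balanced n M \<mu> x" and \<mu>: "20 \<le> \<mu>"
    and r: "2 * real CARD('d) < r * M" "r * M \<le> 3 * real CARD('d)"
  shows "boxed_graph n (geometric_edges n r x) (\<lambda>v. cell M (x v)) touching
     (nearby (3 * CARD('d) + 1)) \<mu> ((2 * (3 * CARD('d) + 1) + 1) ^ CARD('d))"
proof
  let ?V = "{1..n}" and ?E = "geometric_edges n r x"
  have "0 < r * real M" using r(1) by (intro le_less_trans[OF _ r(1)]) simp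
  then have "M \<noteq> 0" by (intro notI) simp
  then have M: "0 < M" by simp
  have cube: "x v \<in> cbox 0 1" if "v \<in> ?V" for v using bal that by (auto simp: balanced_def)
  have cell: "cell M (x v) \<in> cells M" if "v \<in> ?V" for v
    by (rule cell_in_cells[OF cube[OF that] M])
  have count: "\<mu> / 4 < card {i \<in> ?V. cell M (x i) = k}" "card {i \<in> ?V. cell M (x i) = k} < 4 * \<mu>"
    if "k \<in> cells M" for k using bal that by (auto simp: balanced_def)
  have edge_iff: "{u, v} \<in> ?E \<longleftrightarrow> u \<in> ?V \<and> v \<in> ?V \<and> u \<noteq> v \<and> norm (x u - x v) < r" for u v
    unfolding geometric_edges_def by (auto simp: doubleton_eq_iff norm_minus_commute)
  show "\<exists>u v. u \<in> ?V \<and> v \<in> ?V \<and> u \<noteq> v \<and> e = {u, v}" if "e \<in> ?E" for e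
    using that unfolding geometric_edges_def by blast
  show touch_refl: "touching b b" for b :: "'d \<Rightarrow> int" by (simp add: touching_def)
  show "{u, v} \<in> ?E" if uv: "u \<in> ?V" "v \<in> ?V" "u \<noteq> v" "touching (cell M (x u)) (cell M (x v))" for u v
  proof -
    have coord: "\<bar>(x u - x v) $ i\<bar> \<le> 2 / M" for i
    proof -
      have "\<bar>cell M (x u) i - cell M (x v) i\<bar> \<le> 1" using uv(4) by (simp add: touching_def)
      then have "\<bar>real_of_int (cell M (x u) i) - real_of_int (cell M (x v) i)\<bar> \<le> 1" by linarith
      then have "\<bar>real M * x u $ i - real M * x v $ i\<bar> \<le> 2"
        using cell_bounds(3,4)[OF cube[OF uv(1)] M, of i] cell_bounds(3,4)[OF cube[OF uv(2)] M, of i]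
        by linarith
      moreover have "real M * x u $ i - real M * x v $ i = real M * (x u - x v) $ i"
        by (simp add: right_diff_distrib)
      ultimately have "real M * \<bar>(x u - x v) $ i\<bar> \<le> 2" by (simp only: abs_mult abs_of_nat)
      then show ?thesis using M by (simp only: pos_le_divide_eq of_nat_0_less_iff mult.commute)
    qed
    have "norm (x u - x v) \<le> (\<Sum>i\<in>UNIV. \<bar>(x u - x v) $ i\<bar>)" by (rule norm_le_l1_cart)
    also have "\<dots> \<le> (\<Sum>i\<in>(UNIV :: 'd set). 2 / real M)" by (intro sum_mono coord)
    also have "\<dots> = 2 * real CARD('d) / M" by simp
    also have "\<dots> < r" using r(1) M by (simp add: divide_less_eq)
    finally show ?thesis using uv edge_iff by simp
  qed
  show "cell M (x v) \<in> nearby (3 * CARD('d) + 1) (cell M (x u))" if e: "{u, v} \<in> ?E" for u v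
  proof -
    have uv: "u \<in> ?V" "v \<in> ?V" "norm (x u - x v) < r" using e edge_iff by auto
    have "\<bar>cell M (x u) i - cell M (x v) i\<bar> \<le> int (3 * CARD('d) + 1)" for i
    proof -
      have "\<bar>(x u - x v) $ i\<bar> < r" using component_le_norm_cart[of "x u - x v" i] uv(3) by linarith
      then have "real M * \<bar>(x u - x v) $ i\<bar> < real M * r" using M by simp
      moreover have "real M * \<bar>(x u - x v) $ i\<bar> = \<bar>real M * (x u - x v) $ i\<bar>"
        by (simp add: abs_mult)
      moreover have "real M * (x u - x v) $ i = real M * x u $ i - real M * x v $ i"
        by (simp add: right_diff_distrib)
      ultimately have "\<bar>real M * x u $ i - real M * x v $ i\<bar> < 3 * real CARD('d)"
        using r(2) by (simp add: mult.commute)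
      then have "\<bar>real_of_int (cell M (x u) i) - real_of_int (cell M (x v) i)\<bar> < 3 * real CARD('d) + 1"
        using cell_bounds(3,4)[OF cube[OF uv(1)] M, of i] cell_bounds(3,4)[OF cube[OF uv(2)] M, of i]
        by linarith
      then show ?thesis by linarith
    qed
    then show ?thesis by (simp add: nearby_def)
  qed
  show "b \<in> nearby (3 * CARD('d) + 1) b" for b :: "'d \<Rightarrow> int" by (simp add: nearby_def)
  show "b \<in> nearby (3 * CARD('d) + 1) b' \<Longrightarrow> b' \<in> nearby (3 * CARD('d) + 1) b" for b b' :: "'d \<Rightarrow> int"
    by (simp add: nearby_def abs_minus_commute)
  show "finite (nearby (3 * CARD('d) + 1) b)" for b :: "'d \<Rightarrow> int"
    unfolding nearby_eq_PiE by (intro finite_PiE) auto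
  have "card (nearby R b) = (2 * R + 1) ^ CARD('d)" for b :: "'d \<Rightarrow> int" and R
    unfolding nearby_eq_PiE by (simp add: card_PiE nat_add_distrib nat_mult_distrib)
  then show "card (nearby (3 * CARD('d) + 1) b) \<le> (2 * (3 * CARD('d) + 1) + 1) ^ CARD('d)"
    for b :: "'d \<Rightarrow> int" by simp
  show "\<mu> / 4 \<le> card {v \<in> ?V. cell M (x v) = cell M (x u)}" if "u \<in> ?V" for u
    using count(1)[OF cell[OF that]] by simp
  show "card {v \<in> ?V. cell M (x v) = b} \<le> 4 * \<mu>" for b
  proof (cases "b \<in> cells M")
    case True then show ?thesis using count(2)[OF True] by simp
  next
    case False
    then have "{v \<in> ?V. cell M (x v) = b} = {}" using cell by blast
    then show ?thesis using \<mu> by (metis card.empty of_nat_0 mult_nonneg_nonneg order_trans zero_le_numeral)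
  qed
  show "20 \<le> \<mu>" by (rule \<mu>)
  let ?R = "{(u, v). u \<in> ?V \<and> v \<in> ?V \<and> touching (cell M (x u)) (cell M (x v))}"
  have sym: "sym (?R\<^sup>*)"
    by (intro sym_rtrancl) (auto simp: sym_def touching_def abs_minus_commute)
  have occupied: "\<exists>v\<in>?V. cell M (x v) = k" if "k \<in> cells M" for k
  proof (rule ccontr)
    assume "\<not> ?thesis"
    then have "{i \<in> ?V. cell M (x i) = k} = {}" by blast
    then show False using count(1)[OF that] \<mu> by (simp only: card.empty)
  qed
  \<comment> \<open>Moving all coordinates towards \<open>0\<close> step by step leads from any cell to the corner cell through touching cells.\<close>
  define shift :: "nat \<Rightarrow> ('d \<Rightarrow> int) \<Rightarrow> 'd \<Rightarrow> int" where "shift t k = (\<lambda>i. max 0 (k i - int t))" for t k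
  have shift_cells: "shift t k \<in> cells M" if "k \<in> cells M" for t k
  proof -
    have "k i - int t < int M" for i
    proof -
      have "k i < int M" using that by (simp add: cells_def)
      then show ?thesis by linarith
    qed
    then show ?thesis using M by (simp add: shift_def cells_def)
  qed
  have reach: "(u, v) \<in> ?R\<^sup>*" if u: "u \<in> ?V" and "v \<in> ?V" "cell M (x v) = shift t (cell M (x u))" for t u v
    using that(2,3)
  proof (induction t arbitrary: v)
    case 0
    have "cell M (x v) = cell M (x u)"
      using 0 cell_bounds(1)[OF cube[OF u] M] by (auto simp: shift_def fun_eq_iff max_def)
    then have "(u, v) \<in> ?R" using 0 u touch_refl by simp
    then show ?case by blast
  next
    case (Suc t)
    obtain w where w: "w \<in> ?V" "cell M (x w) = shift t (cell M (x u))"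
      using occupied[OF shift_cells[OF cell[OF u]]] by blast
    have "touching (cell M (x w)) (cell M (x v))"
      unfolding w(2) Suc.prems(2) by (auto simp: touching_def shift_def)
    then have "(w, v) \<in> ?R" using w Suc.prems by simp
    then show ?case using Suc.IH[OF w] by (rule rtrancl.rtrancl_into_rtrancl[rotated])
  qed
  show "(u, v) \<in> ?R\<^sup>*" if uv: "u \<in> ?V" "v \<in> ?V" for u v
  proof -
    have "shift M (cell M (x w)) = (\<lambda>_. 0)" if "w \<in> ?V" for w
    proof
      fix i
      have "cell M (x w) i < int M" by (rule cell_bounds(2)[OF cube[OF that] M])
      then show "shift M (cell M (x w)) i = 0" by (simp add: shift_def)
    qed
    moreover obtain z where "z \<in> ?V" "cell M (x z) = (\<lambda>_. 0)"
      using occupied[of "\<lambda>_. 0"] M by (auto simp: cells_def)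
    ultimately have "(u, z) \<in> ?R\<^sup>*" "(v, z) \<in> ?R\<^sup>*" using reach[of _ z M] uv by auto
    then show ?thesis using sym by (meson rtrancl_trans symD)
  qed
qed

section \<open>The two sides of the threshold\<close>

text \<open>Bad point configurations are charged their full probability.\<close>
lemma irrigation_law_le:
  fixes G :: "(nat \<Rightarrow> real ^ 'd) set"
  assumes G: "G \<in> sets (uniform_points n)" and \<delta>: "0 \<le> \<delta>"
    and le: "\<And>x. x \<in> G \<Longrightarrow> measure_pmf.prob (irrigation_pmf n c (geometric_edges n r x)) A \<le> \<delta>"
  shows "measure (irrigation_law TYPE('d) n r c) A \<le> \<delta> + (1 - measure (uniform_points n) G)"
proof -
  let ?P = "uniform_points n :: (nat \<Rightarrow> real ^ 'd) measure"
  let ?f = "\<lambda>x. measure_pmf.prob (irrigation_pmf n c (geometric_edges n r x)) A"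
  interpret P: prob_space ?P by (rule prob_space_uniform_points)
  have meas: "?f \<in> borel_measurable ?P"
    by (rule measurable_compose[OF irrigation_kernel_measurable measurable_measure_subprob_algebra]) simp
  have intf: "integrable ?P ?f"
    by (rule P.integrable_const_bound[of _ 1, OF _ meas]) simp
  have indG: "integrable ?P (indicator G :: _ \<Rightarrow> real)"
    using G by (intro integrable_real_indicator) (auto simp: less_top[symmetric])
  have "measure (irrigation_law TYPE('d) n r c) A = (\<integral>x. ?f x \<partial>?P)" by (rule measure_irrigation_law)
  also have "\<dots> \<le> (\<integral>x. (\<delta> + 1) - indicator G x \<partial>?P)"
  proof (rule integral_mono[OF intf])
    show "integrable ?P (\<lambda>x. (\<delta> + 1) - indicator G x :: real)" using indG by simp
    show "?f x \<le> (\<delta> + 1) - indicator G x" for x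
    proof (cases "x \<in> G")
      case True then show ?thesis using le[OF True] by simp
    next
      case False
      have "?f x \<le> 1" by simp
      then have "?f x \<le> \<delta> + 1" using \<delta> by linarith
      then show ?thesis using False by simp
    qed
  qed
  also have "\<dots> = \<delta> + (1 - measure ?P G)"
    using indG G by (simp add: P.prob_space)
  finally show ?thesis .
qed

lemma sets_irrigation_law: "sets (irrigation_law TYPE('d::finite) n r c) = UNIV"
proof -
  interpret P: prob_space "uniform_points n :: (nat \<Rightarrow> real ^ 'd) measure"
    by (rule prob_space_uniform_points)
  show ?thesis
    unfolding irrigation_law_def by (subst sets_bind[where N = "count_space UNIV"]) (auto simp: P.not_empty)
qed

text \<open>The number \<open>M\<close> is the smallest one with \<open>r M > 2 d\<close>. Since \<open>r\<^sup>d = \<gamma>\<^sup>d L / n\<close>, the mean number of points per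
  cell is \<open>n / M\<^sup>d = (\<gamma> / (r M))\<^sup>d L\<close>, and \<open>\<gamma> \<ge> 24 d\<close> makes it at least \<open>8 L\<close>.\<close>
lemma grid_scale:
  fixes \<gamma> L :: real and n d :: nat
  assumes d: "1 \<le> d" and \<gamma>: "24 * real d \<le> \<gamma>" and n: "0 < n" and L: "0 < L"
  defines "r \<equiv> \<gamma> * (L / real n) powr (1 / real d)"
  assumes r: "r \<le> real d"
  defines "M \<equiv> nat \<lfloor>2 * real d / r\<rfloor> + 1"
  shows "2 * real d < r * M" "r * M \<le> 3 * real d"
    "8 * L \<le> real n / real M ^ d" "real n / real M ^ d \<le> (\<gamma> / (2 * real d)) ^ d * L"
proof -
  have \<gamma>0: "0 < \<gamma>" using \<gamma> d by (intro less_le_trans[OF _ \<gamma>]) simp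
  have t: "0 < L / real n" using n L by simp
  have pow0: "0 < (L / real n) powr (1 / real d)" by (subst powr_gt_zero) (use t in linarith)
  have r0: "0 < r" using \<gamma>0 pow0 by (simp only: r_def mult_pos_pos)
  have "((L / real n) powr (1 / real d)) ^ d = ((L / real n) powr (1 / real d)) powr real d"
    by (rule powr_realpow[OF pow0, symmetric])
  also have "\<dots> = (L / real n) powr 1" using d by (simp only: powr_powr) simp
  also have "\<dots> = L / real n" using t by (simp only: powr_one less_imp_le)
  finally have rd: "r ^ d = \<gamma> ^ d * (L / real n)" by (simp add: r_def power_mult_distrib)
  have M0: "0 < real M" by (simp add: M_def)
  have Mreal: "real M = real_of_int \<lfloor>2 * real d / r\<rfloor> + 1"
    using r0 by (simp add: M_def)
  have "2 * real d / r < real M" unfolding Mreal by linarith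
  then show lo: "2 * real d < r * M" using r0 by (simp add: field_simps)
  have "real M \<le> 2 * real d / r + 1" unfolding Mreal by linarith
  then show hi: "r * M \<le> 3 * real d" using r0 r by (simp add: field_simps)
  have nM: "real n / real M ^ d = (\<gamma> / (r * M)) ^ d * L"
    using rd r0 M0 n L \<gamma>0 by (simp add: power_divide power_mult_distrib field_simps)
  have pos: "0 < r * M" using r0 M0 by simp
  have "8 \<le> \<gamma> / (3 * real d)" using \<gamma> d by (simp add: field_simps)
  also have "\<dots> \<le> \<gamma> / (r * M)" using \<gamma>0 hi pos by (intro divide_left_mono) auto
  finally have g: "8 \<le> \<gamma> / (r * M)" .
  also have "\<dots> \<le> (\<gamma> / (r * M)) ^ d" using g d by (intro self_le_power) auto
  finally show "8 * L \<le> real n / real M ^ d" unfolding nM using L by (intro mult_right_mono) auto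
  have "\<gamma> / (r * M) \<le> \<gamma> / (2 * real d)"
    using \<gamma>0 lo pos d by (intro divide_left_mono) auto
  then show "real n / real M ^ d \<le> (\<gamma> / (2 * real d)) ^ d * L"
    unfolding nM using g L by (intro mult_right_mono power_mono) auto
qed

text \<open>A mean of at least \<open>8 L\<close> points per cell bounds the failure probability of one cell by
  \<open>2 exp (- 2 L) = 2 / n\<^sup>2\<close>, and there are at most \<open>n\<close> cells.\<close>
lemma geometric_graph_boxed:
  fixes \<gamma> :: real
  assumes \<gamma>: "24 * real CARD('d::finite) \<le> \<gamma>"
  defines "r \<equiv> \<lambda>n. \<gamma> * (ln (real n) / real n) powr (1 / real CARD('d))"
  shows "\<exists>B > 0. \<exists>near :: ('d \<Rightarrow> int) \<Rightarrow> ('d \<Rightarrow> int) set. \<exists>C. \<forall>\<^sub>F n in sequentially.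
    \<exists>\<mu>. 8 * ln (real n) \<le> \<mu> \<and> \<mu> \<le> B * ln (real n) \<and>
      (\<exists>G \<in> sets (uniform_points n :: (nat \<Rightarrow> real ^ 'd) measure). 1 - 2 / real n \<le> measure (uniform_points n) G \<and>
         (\<forall>x\<in>G. \<exists>box. boxed_graph n (geometric_edges n (r n) x) box touching near \<mu> C))"
proof -
  let ?d = "CARD('d)"
  let ?near = "nearby (3 * ?d + 1) :: ('d \<Rightarrow> int) \<Rightarrow> _" and ?C = "(2 * (3 * ?d + 1) + 1) ^ ?d"
  let ?B = "(\<gamma> / (2 * real ?d)) ^ ?d"
  have d: "1 \<le> ?d" by (simp add: Suc_leI)
  have \<gamma>0: "0 < \<gamma>" using \<gamma> d by (intro less_le_trans[OF _ \<gamma>]) simp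
  have "((\<lambda>n. ln (real n) / real n) \<longlongrightarrow> 0) sequentially" by real_asymp
  then have "((\<lambda>n. (ln (real n) / real n) powr (1 / real ?d)) \<longlongrightarrow> 0) sequentially"
    by (rule tendsto_zero_powrI[OF _ tendsto_const]) (real_asymp, simp)
  then have "(r \<longlongrightarrow> \<gamma> * 0) sequentially" unfolding r_def by (intro tendsto_mult tendsto_const)
  then have "\<forall>\<^sub>F n in sequentially. r n < real ?d"
    using d by (intro order_tendstoD) auto
  moreover have "\<forall>\<^sub>F n in sequentially. 3 \<le> ln (real n)" by real_asymp
  moreover have "\<forall>\<^sub>F n in sequentially. 0 < n" by (rule eventually_gt_at_top)
  ultimately have ev: "\<forall>\<^sub>F n in sequentially.
    \<exists>\<mu>. 8 * ln (real n) \<le> \<mu> \<and> \<mu> \<le> ?B * ln (real n) \<and>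
      (\<exists>G \<in> sets (uniform_points n :: (nat \<Rightarrow> real ^ 'd) measure). 1 - 2 / real n \<le> measure (uniform_points n) G \<and>
         (\<forall>x\<in>G. \<exists>box. boxed_graph n (geometric_edges n (r n) x) box touching ?near \<mu> ?C))"
  proof eventually_elim
    case (elim n)
    define M where "M = nat \<lfloor>2 * real ?d / r n\<rfloor> + 1"
    define \<mu> where "\<mu> = real n / real M ^ ?d"
    have L: "0 < ln (real n)" using elim(2) by linarith
    have r_eq: "\<gamma> * (ln (real n) / real n) powr (1 / real ?d) = r n" by (simp add: r_def)
    note scale = grid_scale[OF d \<gamma> elim(3) L, unfolded r_eq, OF less_imp_le[OF elim(1)], folded M_def, folded \<mu>_def]
    have M: "0 < M" by (simp add: M_def)
    obtain G where G: "G \<in> sets (uniform_points n :: (nat \<Rightarrow> real ^ 'd) measure)"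
      "\<And>x. x \<in> G \<Longrightarrow> balanced n M \<mu> x"
      "1 - 2 * real M ^ ?d * exp (- \<mu> / 4) \<le> measure (uniform_points n) G"
      using balanced_prob[OF M, of n, where 'd = 'd] unfolding \<mu>_def by blast
    have \<mu>20: "20 \<le> \<mu>" using scale(3) elim(2) by linarith
    have "2 * real M ^ ?d * exp (- \<mu> / 4) \<le> 2 / real n"
    proof -
      have "real M ^ ?d = real n / \<mu>" using elim(3) M by (simp add: \<mu>_def)
      also have "\<dots> \<le> real n" using \<mu>20 elim(3) by (simp add: divide_le_eq mult_le_cancel_left1)
      finally have "real M ^ ?d \<le> real n" .
      moreover have "exp (- \<mu> / 4) \<le> exp (- (2 * ln (real n)))" using scale(3) by simp
      moreover have "exp (- (2 * ln (real n))) = 1 / (real n * real n)"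
      proof -
        have "exp (- ln (real n)) = 1 / real n" using elim(3) by (simp add: exp_minus divide_inverse)
        moreover have "- (2 * ln (real n)) = - ln (real n) + - ln (real n)" by simp
        ultimately show ?thesis by (simp only: exp_add) simp
      qed
      ultimately have "2 * real M ^ ?d * exp (- \<mu> / 4) \<le> 2 * real n * (1 / (real n * real n))"
        by (intro mult_mono) auto
      then show ?thesis using elim(3) by simp
    qed
    then have "1 - 2 / real n \<le> measure (uniform_points n) G" using G(3) by linarith
    moreover have "boxed_graph n (geometric_edges n (r n) x) (\<lambda>v. cell M (x v)) touching ?near \<mu> ?C"
      if "x \<in> G" for x
      by (rule balanced_boxed_graph[OF G(2)[OF that] \<mu>20 scale(1,2)])
    ultimately show ?case using G(1) scale(3,4) by blast
  qed
  have "0 < ?B" using \<gamma>0 d by simp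
  then show ?thesis using ev by blast
qed

text \<open>The terms with \<open>m k \<ge> 3 L\<close> are at most \<open>exp (- 2 L)\<close>, thanks to the base \<open>1 / 10\<close>. For smaller \<open>k\<close> the base is
  at most \<open>k / L < 3 / m\<close>, so a term is at most \<open>n (\<Delta>\<^sup>2 (3 / m)\<^sup>m)\<^sup>k\<close>; as \<open>k > m\<close>, this is
  \<open>exp (L - m\<^sup>2 ln m (1 + o(1)))\<close> at most, and \<open>m\<^sup>2 ln m\<close> exceeds \<open>(1 + \<epsilon> / 4) L\<close> above the threshold.
  There are at most \<open>3 L\<close> such \<open>k\<close>. The value \<open>a = \<mu> / (50 C)\<close> is chosen such that
  \<open>C a / (\<mu> / 5) = 1 / 10\<close>.\<close>
lemma connectivity_bound:
  fixes L y \<epsilon> \<mu> B \<Delta> a :: real and n m C :: nat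
  assumes n: "real n = exp L" and L: "0 < L" and C: "1 \<le> C"
    and \<mu>: "8 * L \<le> \<mu>" "\<mu> \<le> B * L" and y: "3 \<le> y" "y \<le> real m"
    and h1: "90000 * real C ^ 3 \<le> real m" and h2: "2 * ln (4 * real C * B * L) \<le> y"
    and h3: "(1 + \<epsilon> / 4) * L \<le> y * (y * ln (y / 3) - 2 * ln (4 * real C * B * L))"
    and \<epsilon>: "0 < \<epsilon>" and Delta: "\<Delta> = 4 * real C * \<mu>" and a: "a = \<mu> / (50 * real C)"
  shows "(real n)\<^sup>2 * exp (8 * \<mu>) * exp (- real m * a\<^sup>2 / \<Delta>) +
       (\<Sum>k = Suc m..n. real n * \<Delta> ^ (2 * k) * (min (real k / (\<mu> / 5)) (C * a / (\<mu> / 5))) ^ (m * k))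
     \<le> exp (- 6 * L) + exp (- L) + 3 * L * exp (- (\<epsilon> / 4 * L))"
proof -
  have \<mu>0: "0 < \<mu>" using \<mu> L by linarith
  have C0: "0 < real C" using C by simp
  have "real m * a\<^sup>2 / \<Delta> = real m * \<mu> / (10000 * real C ^ 3)"
    using \<mu>0 C0 by (simp add: a Delta power2_eq_square power3_eq_cube field_simps)
  also have "\<dots> \<ge> 90000 * real C ^ 3 * \<mu> / (10000 * real C ^ 3)"
    using \<mu>0 C0 by (intro divide_right_mono mult_right_mono h1) auto
  finally have "9 * \<mu> \<le> real m * a\<^sup>2 / \<Delta>" using C0 by simp
  then have "2 * L + 8 * \<mu> - real m * a\<^sup>2 / \<Delta> \<le> - 6 * L" using \<mu> by linarith
  then have "exp (2 * L + 8 * \<mu> - real m * a\<^sup>2 / \<Delta>) \<le> exp (- 6 * L)" by simp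
  moreover have "(real n)\<^sup>2 * exp (8 * \<mu>) * exp (- real m * a\<^sup>2 / \<Delta>) = exp (2 * L + 8 * \<mu> - real m * a\<^sup>2 / \<Delta>)"
  proof -
    have "2 * L + 8 * \<mu> - real m * a\<^sup>2 / \<Delta> = (L + L) + 8 * \<mu> + (- real m * a\<^sup>2 / \<Delta>)" by simp
    then show ?thesis by (simp only: n power2_eq_square exp_add)
  qed
  ultimately have split: "(real n)\<^sup>2 * exp (8 * \<mu>) * exp (- real m * a\<^sup>2 / \<Delta>) \<le> exp (- 6 * L)" by simp
  define q where "q k = min (real k / (\<mu> / 5)) (C * a / (\<mu> / 5))" for k :: nat
  have \<Delta>0: "0 < \<Delta>" using \<mu>0 C0 by (simp add: Delta)
  have "\<Delta> \<le> 4 * real C * B * L"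
    using \<mu>(2) C0 by (simp add: Delta mult.assoc mult_left_mono)
  then have ln\<Delta>: "ln \<Delta> \<le> ln (4 * real C * B * L)"
    using \<Delta>0 by (subst ln_le_cancel_iff) linarith+
  have m3: "3 \<le> real m" using y by linarith
  have summand: "real n * \<Delta> ^ (2 * k) * q k ^ (m * k)
      \<le> exp (- 2 * L) + (if real m * real k < 3 * L then exp (- (\<epsilon> / 4 * L)) else 0)"
    if k: "m < k" for k
  proof -
    have powers: "real n * \<Delta> ^ (2 * k) * q k ^ (m * k) \<le> exp (L + 2 * real k * ln \<Delta> - real m * real k * z)"
      if q: "q k \<le> exp (- z)" for z :: real
    proof -
      have q0: "0 \<le> q k" using \<mu>0 C0 by (simp add: q_def a)
      have "\<Delta> ^ (2 * k) = exp (2 * real k * ln \<Delta>)"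
        using \<Delta>0 exp_of_nat_mult[of "2 * k" "ln \<Delta>"] by simp
      moreover have "q k ^ (m * k) \<le> exp (- z) ^ (m * k)" using q q0 by (rule power_mono)
      moreover have "exp (- z) ^ (m * k) = exp (- (real m * real k * z))" by (simp add: exp_of_nat_mult[symmetric])
      ultimately have "real n * \<Delta> ^ (2 * k) * q k ^ (m * k) \<le> exp L * exp (2 * real k * ln \<Delta>) * exp (- (real m * real k * z))"
        unfolding n by (simp add: mult_left_mono)
      moreover have "L + 2 * real k * ln \<Delta> - real m * real k * z = L + 2 * real k * ln \<Delta> + - (real m * real k * z)" by simp
      ultimately show ?thesis by (simp only: exp_add)
    qed
    show ?thesis
    proof (cases "real m * real k < 3 * L")
      case False
      have "C * a / (\<mu> / 5) = 1 / 10" using C0 \<mu>0 by (simp add: a)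
      moreover have "1 / 10 \<le> exp (- 2 :: real)"
      proof -
        have "exp (2 :: real) = exp 1 * exp 1" by (simp add: exp_add[symmetric])
        also have "\<dots> \<le> 3 * 3" using exp_le by (intro mult_mono) auto
        finally show ?thesis by (simp add: exp_minus field_simps)
      qed
      ultimately have "q k \<le> exp (- 2)" by (simp add: q_def min_le_iff_disj)
      then have "real n * \<Delta> ^ (2 * k) * q k ^ (m * k) \<le> exp (L + 2 * real k * ln \<Delta> - real m * real k * 2)"
        by (rule powers)
      also have "\<dots> \<le> exp (- 2 * L)"
      proof -
        have "2 * ln \<Delta> \<le> real m" using ln\<Delta> h2 y by linarith
        then have "real k * (2 * ln \<Delta>) \<le> real k * real m" by (intro mult_left_mono) auto
        moreover have "3 * L \<le> real k * real m" using False by (simp add: mult.commute)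
        ultimately have "L + 2 * real k * ln \<Delta> - real m * real k * 2 \<le> - 2 * L"
          by (simp add: algebra_simps)
        then show ?thesis by simp
      qed
      finally show ?thesis using False by simp
    next
      case True
      have k0: "0 < real k" using k by simp
      have "q k \<le> real k / (\<mu> / 5)" by (simp add: q_def)
      also have "\<dots> \<le> real k / L" using \<mu> L k0 by (intro divide_left_mono) auto
      also have "\<dots> \<le> 3 / real m" using True L m3 by (simp add: field_simps)
      also have "\<dots> = exp (- ln (real m / 3))" using m3 by (simp add: exp_minus)
      finally have "real n * \<Delta> ^ (2 * k) * q k ^ (m * k) \<le> exp (L + 2 * real k * ln \<Delta> - real m * real k * ln (real m / 3))"
        by (rule powers)
      also have "\<dots> \<le> exp (- (\<epsilon> / 4 * L))"
      proof -
        let ?D = "ln (4 * real C * B * L)"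
        have "y * ln (y / 3) \<le> real m * ln (real m / 3)"
          using y by (intro mult_mono) auto
        then have le: "y * ln (y / 3) - 2 * ?D \<le> real m * ln (real m / 3) - 2 * ln \<Delta>" using ln\<Delta> by linarith
        have "0 < y * (y * ln (y / 3) - 2 * ?D)"
          using h3 \<epsilon> L by (intro less_le_trans[OF _ h3]) simp
        then have "0 \<le> y * ln (y / 3) - 2 * ?D" using y by (simp add: zero_less_mult_iff)
        then have "y * (y * ln (y / 3) - 2 * ?D) \<le> real k * (real m * ln (real m / 3) - 2 * ln \<Delta>)"
          using le y k by (intro mult_mono) auto
        then have "(1 + \<epsilon> / 4) * L \<le> real k * (real m * ln (real m / 3) - 2 * ln \<Delta>)" using h3 by linarith
        then have "L + 2 * real k * ln \<Delta> - real m * real k * ln (real m / 3) \<le> - (\<epsilon> / 4 * L)"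
          by (simp add: algebra_simps)
        then show ?thesis by simp
      qed
      finally show ?thesis using True by (simp add: add_increasing)
    qed
  qed
  have "(\<Sum>k = Suc m..n. real n * \<Delta> ^ (2 * k) * q k ^ (m * k))
    \<le> (\<Sum>k = Suc m..n. exp (- 2 * L) + (if real m * real k < 3 * L then exp (- (\<epsilon> / 4 * L)) else 0))"
    by (intro sum_mono summand) simp
  also have "\<dots> = real (n - m) * exp (- 2 * L) +
      real (card {k \<in> {Suc m..n}. real m * real k < 3 * L}) * exp (- (\<epsilon> / 4 * L))"
    by (simp add: sum.distrib sum.If_cases Int_def)
  also have "\<dots> \<le> real n * exp (- 2 * L) + 3 * L * exp (- (\<epsilon> / 4 * L))"
  proof (intro add_mono mult_right_mono)
    have "{k \<in> {Suc m..n}. real m * real k < 3 * L} \<subseteq> {1..nat \<lfloor>3 * L\<rfloor>}"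
    proof
      fix k assume k: "k \<in> {k \<in> {Suc m..n}. real m * real k < 3 * L}"
      have "1 * real k \<le> real m * real k" using m3 by (intro mult_right_mono) auto
      moreover have "real m * real k < 3 * L" using k by blast
      ultimately have "real k \<le> 3 * L" by linarith
      then show "k \<in> {1..nat \<lfloor>3 * L\<rfloor>}" using k by (simp add: le_nat_floor)
    qed
    then have "card {k \<in> {Suc m..n}. real m * real k < 3 * L} \<le> card {1..nat \<lfloor>3 * L\<rfloor>}"
      by (rule card_mono[rotated]) simp
    then show "real (card {k \<in> {Suc m..n}. real m * real k < 3 * L}) \<le> 3 * L" using L by simp linarith
  qed auto
  also have "real n * exp (- 2 * L) = exp (- L)" by (simp add: n exp_add[symmetric])
  finally show ?thesis using split by (simp add: q_def)
qed

text \<open>The cost \<open>c ln (e X / c)\<close> of one member increases with \<open>c\<close> as long as \<open>c \<le> X\<close>, so the worst case is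
  \<open>c = y\<close>, the threshold value.\<close>
lemma isolation_bound:
  fixes L y \<epsilon> X \<Delta> :: real and n c C :: nat
  assumes n: "real n = exp L" and c: "1 \<le> c" "real c \<le> y" and y: "y \<le> X" and \<Delta>: "1 \<le> \<Delta>" "\<Delta> \<le> X"
    and h: "\<epsilon> / 4 * L \<le> L - 2 * ln X - (y + 1) * y * ln (exp 1 * X / y) - 80 * real C * (y * (y + 1))"
  shows "exp (- (real n / \<Delta>\<^sup>2 * ((real c / (exp 1 * \<Delta>)) ^ (c * (c + 1)) *
          exp (- 80 * real C * (real c * (real c + 1)))))) \<le> exp (- exp (\<epsilon> / 4 * L))"
proof -
  have X0: "0 < X" using \<Delta> by linarith
  have c0: "0 < real c" using c by simp
  have y0: "0 < y" using c0 c by linarith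
  have "real c * ln (exp 1 * X / real c) \<le> y * ln (exp 1 * X / y)"
  proof -
    \<comment> \<open>Concavity of the logarithm: \<open>ln (y / c) \<le> y / c - 1\<close>.\<close>
    have "1 \<le> 1 + ln (X / y)" using y y0 by simp
    also have "\<dots> = ln (exp 1 * X / y)" using X0 y0 by (simp add: ln_mult ln_div)
    finally have one: "1 \<le> ln (exp 1 * X / y)" .
    have "ln (exp 1 * X / real c) = ln (exp 1 * X / y) + ln (y / real c)"
      using X0 y0 c0 by (simp add: ln_mult ln_div)
    moreover have "real c * ln (y / real c) \<le> real c * (y / real c - 1)"
      using ln_le_minus_one[of "y / real c"] y0 c0 by (intro mult_left_mono) auto
    moreover have "real c * (y / real c - 1) = y - real c" using c0 by (simp add: field_simps)
    moreover have "(y - real c) * 1 \<le> (y - real c) * ln (exp 1 * X / y)"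
      using one c by (intro mult_left_mono) auto
    ultimately show ?thesis by (simp add: algebra_simps)
  qed
  moreover have "0 \<le> ln (exp 1 * X / real c)"
  proof -
    have "real c \<le> exp 1 * X"
    proof -
      have "1 * X \<le> exp 1 * X" using X0 by (intro mult_right_mono) auto
      then show ?thesis using c y by linarith
    qed
    then show ?thesis using c0 by simp
  qed
  ultimately have main: "(real c + 1) * (real c * ln (exp 1 * X / real c)) \<le> (y + 1) * (y * ln (exp 1 * X / y))"
    using c by (intro mult_mono[of "real c + 1" "y + 1" "real c * ln (exp 1 * X / real c)"]) auto
  have "real c * (real c + 1) \<le> y * (y + 1)" using c by (intro mult_mono) auto
  then have small: "80 * real C * (real c * (real c + 1)) \<le> 80 * real C * (y * (y + 1))"
    by (intro mult_left_mono) auto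
  have "exp (- ((real c + 1) * (real c * ln (exp 1 * X / real c)))) = (real c / (exp 1 * X)) ^ (c * (c + 1))"
  proof -
    have ln_inv: "ln (real c / (exp 1 * X)) = - ln (exp 1 * X / real c)"
      using X0 c0 by (simp add: ln_div ln_mult)
    have "- ((real c + 1) * (real c * ln (exp 1 * X / real c))) = real (c * (c + 1)) * ln (real c / (exp 1 * X))"
      unfolding ln_inv by (simp add: algebra_simps)
    then have "exp (- ((real c + 1) * (real c * ln (exp 1 * X / real c)))) = exp (ln (real c / (exp 1 * X))) ^ (c * (c + 1))"
      by (simp only: exp_of_nat_mult)
    then show ?thesis using X0 c0 by simp
  qed
  also have "\<dots> \<le> (real c / (exp 1 * \<Delta>)) ^ (c * (c + 1))"
    using X0 c0 \<Delta> by (intro power_mono divide_left_mono mult_left_mono) auto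
  finally have p: "exp (- ((real c + 1) * (real c * ln (exp 1 * X / real c)))) \<le> (real c / (exp 1 * \<Delta>)) ^ (c * (c + 1))" .
  have nD: "exp (L - 2 * ln X) \<le> real n / \<Delta>\<^sup>2"
  proof -
    have "exp (L - 2 * ln X) = real n / X\<^sup>2"
    proof -
      have "exp (2 * ln X) = X\<^sup>2" using X0 exp_of_nat_mult[of 2 "ln X"] by simp
      then show ?thesis by (simp add: n exp_diff)
    qed
    also have "\<dots> \<le> real n / \<Delta>\<^sup>2" using \<Delta> X0 by (intro divide_left_mono power_mono) auto
    finally show ?thesis .
  qed
  have "exp (\<epsilon> / 4 * L) \<le> exp (L - 2 * ln X) * (exp (- ((real c + 1) * (real c * ln (exp 1 * X / real c)))) *
      exp (- 80 * real C * (real c * (real c + 1))))"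
    unfolding exp_add[symmetric] exp_le_cancel_iff using h main small by (simp add: algebra_simps)
  also have "\<dots> \<le> real n / \<Delta>\<^sup>2 * ((real c / (exp 1 * \<Delta>)) ^ (c * (c + 1)) * exp (- 80 * real C * (real c * (real c + 1))))"
    using \<Delta> by (intro mult_mono nD p order_refl) auto
  finally show ?thesis by simp
qed

text \<open>With \<open>x = ln n\<close> and \<open>y\<close> of order \<open>sqrt (x / ln x)\<close>, both \<open>ln y\<close> and \<open>ln (x / y)\<close> are asymptotic to
  \<open>ln x / 2\<close>. Hence \<open>y\<^sup>2 ln y\<close> and \<open>y\<^sup>2 ln (x / y)\<close> are both asymptotic to \<open>\<beta>\<^sup>2 x / 2\<close>, which explains why the
  two halves of the theorem meet at \<open>\<beta>\<^sup>2 = 2\<close>.\<close>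
lemma scale_asymptotics:
  fixes \<beta> K E :: real
  assumes "0 < \<beta>" "0 < K"
  defines "y \<equiv> \<lambda>x::real. \<beta> * sqrt (x / ln x)"
  shows "((\<lambda>x. y x * (y x * ln (y x / 3) - 2 * ln (K * x)) / x) \<longlongrightarrow> \<beta>\<^sup>2 / 2) at_top"
    and "((\<lambda>x. (x - 2 * ln (K * x) - (y x + 1) * y x * ln (exp 1 * (K * x) / y x) - E * (y x * (y x + 1))) / x)
           \<longlongrightarrow> 1 - \<beta>\<^sup>2 / 2) at_top"
    and "eventually (\<lambda>x. E \<le> y x) at_top"
    and "eventually (\<lambda>x. 2 * ln (K * x) \<le> y x) at_top"
    and "eventually (\<lambda>x. 3 * y x + 3 \<le> 8 * x / 10) at_top"
    and "eventually (\<lambda>x. y x \<le> K * x) at_top"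
  unfolding y_def using assms(1,2) by (real_asymp simp: power2_eq_square)+

lemma connectivity_error_tendsto:
  fixes \<epsilon> :: real
  assumes "0 < \<epsilon>"
  shows "((\<lambda>x. exp (- 6 * x) + exp (- x) + 3 * x * exp (- (\<epsilon> / 4 * x))) \<longlongrightarrow> 0) at_top"
proof -
  have "((\<lambda>x :: real. exp (- 6 * x) + exp (- x)) \<longlongrightarrow> 0) at_top" by real_asymp
  moreover have "((\<lambda>x. 3 * x * exp (- (\<epsilon> / 4 * x))) \<longlongrightarrow> 0) at_top"
    using assms by real_asymp
  ultimately show ?thesis by (rule tendsto_add_zero)
qed

lemma isolation_error_tendsto:
  fixes \<epsilon> :: real
  assumes "0 < \<epsilon>"
  shows "((\<lambda>x. exp (- exp (\<epsilon> / 4 * x))) \<longlongrightarrow> 0) at_top"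
  using assms by real_asymp

text \<open>The bounds are applied with \<open>m\<close> the threshold rounded up instead of \<open>c n\<close>, because \<open>c n\<close> may be
  much larger than all degrees.\<close>
lemma connected_prob_tendsto_1:
  fixes \<gamma> \<epsilon> :: real and c :: "nat \<Rightarrow> nat"
  assumes \<gamma>: "24 * real CARD('d::finite) \<le> \<gamma>" and \<epsilon>: "0 < \<epsilon>"
    and c: "\<forall>\<^sub>F n in sequentially. sqrt ((2 + \<epsilon>) * ln (real n) / ln (ln (real n))) \<le> real (c n)"
  defines "r \<equiv> \<lambda>n. \<gamma> * (ln (real n) / real n) powr (1 / real CARD('d))"
  shows "(\<lambda>n. measure (irrigation_law TYPE('d) n (r n) (c n)) {E. graph_connected n E}) \<longlonglongrightarrow> 1"
proof -
  obtain B C and near :: "('d \<Rightarrow> int) \<Rightarrow> ('d \<Rightarrow> int) set" where B: "0 < B"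
    and boxed: "\<forall>\<^sub>F n in sequentially.
    \<exists>\<mu>. 8 * ln (real n) \<le> \<mu> \<and> \<mu> \<le> B * ln (real n) \<and>
      (\<exists>G \<in> sets (uniform_points n :: (nat \<Rightarrow> real ^ 'd) measure). 1 - 2 / real n \<le> measure (uniform_points n) G \<and>
         (\<forall>x\<in>G. \<exists>box. boxed_graph n (geometric_edges n (r n) x) box touching near \<mu> C))"
    using geometric_graph_boxed[OF \<gamma>] unfolding r_def by blast
  \<comment> \<open>The maximum makes \<open>K\<close> positive before \<open>C \<ge> 1\<close> is known, which follows only once a boxed graph is given.\<close>
  define K where "K = 4 * max 1 (real C) * B"
  define \<beta> where "\<beta> = sqrt (2 + \<epsilon>)"
  define y where "y x = \<beta> * sqrt (x / ln x)" for x :: real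
  have \<beta>: "0 < \<beta>" "\<beta>\<^sup>2 = 2 + \<epsilon>" using \<epsilon> by (auto simp: \<beta>_def)
  have K: "0 < K" using B by (simp add: K_def)
  define err where "err x = exp (- 6 * x) + exp (- x) + 3 * x * exp (- (\<epsilon> / 4 * x))" for x :: real
  have lnlim: "filterlim (\<lambda>n. ln (real n)) at_top sequentially" by real_asymp
  have lead: "\<forall>\<^sub>F x in at_top. 1 + \<epsilon> / 4 < y x * (y x * ln (y x / 3) - 2 * ln (K * x)) / x"
    using scale_asymptotics(1)[OF \<beta>(1) K] \<epsilon> \<beta>(2) unfolding y_def by (intro order_tendstoD) auto
  have ev: "\<forall>\<^sub>F x in at_top. 1 + \<epsilon> / 4 < y x * (y x * ln (y x / 3) - 2 * ln (K * x)) / x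
      \<and> 90000 * real C ^ 3 \<le> y x \<and> 3 \<le> y x \<and> 2 * ln (K * x) \<le> y x \<and> 3 * y x + 3 \<le> 8 * x / 10 \<and> 3 \<le> x"
    using lead scale_asymptotics(3)[OF \<beta>(1) K, of "90000 * real C ^ 3"] scale_asymptotics(3)[OF \<beta>(1) K, of 3]
      scale_asymptotics(4,5)[OF \<beta>(1) K] eventually_ge_at_top[of "3 :: real"]
    unfolding y_def by (intro eventually_conj)
  have bound: "\<forall>\<^sub>F n in sequentially.
     1 - (err (ln (real n)) + 2 / real n) \<le> measure (irrigation_law TYPE('d) n (r n) (c n)) {E. graph_connected n E}"
    using boxed c eventually_compose_filterlim[OF ev lnlim] eventually_gt_at_top[of 0]
  proof eventually_elim
    case (elim n)
    define L where "L = ln (real n)"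
    have n: "real n = exp L" using elim(4) by (simp add: L_def)
    obtain \<mu> G where \<mu>: "8 * L \<le> \<mu>" "\<mu> \<le> B * L"
      and G: "G \<in> sets (uniform_points n :: (nat \<Rightarrow> real ^ 'd) measure)" "1 - 2 / real n \<le> measure (uniform_points n) G"
        "\<forall>x\<in>G. \<exists>box. boxed_graph n (geometric_edges n (r n) x) box touching near \<mu> C"
      using elim(1) unfolding L_def by blast
    have ev: "1 + \<epsilon> / 4 < y L * (y L * ln (y L / 3) - 2 * ln (K * L)) / L"
      "90000 * real C ^ 3 \<le> y L" "3 \<le> y L" "2 * ln (K * L) \<le> y L" "3 * y L + 3 \<le> 8 * L / 10" "3 \<le> L"
      using elim(3) unfolding L_def by blast+
    define m where "m = nat \<lceil>y L\<rceil>"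
    have m: "y L \<le> real m" "real m \<le> y L + 1" using ev(3) by (auto simp: m_def)
    have "y L = sqrt ((2 + \<epsilon>) * ln (real n) / ln (ln (real n)))"
      by (simp add: y_def \<beta>_def L_def real_sqrt_mult[symmetric] del: real_sqrt_mult)
    then have "y L \<le> real (c n)" using elim(2) by simp
    then have mc: "m \<le> c n" by (simp add: m_def ceiling_le_iff nat_le_iff)
    have L0: "0 < L" using ev(6) by linarith
    have err0: "0 \<le> err L" using L0 by (simp add: err_def)
    have "measure (irrigation_law TYPE('d) n (r n) (c n)) {E. \<not> graph_connected n E}
       \<le> err L + (1 - measure (uniform_points n) G)"
    proof (rule irrigation_law_le[OF G(1) err0])
      fix x assume "x \<in> G"
      then obtain box where "boxed_graph n (geometric_edges n (r n) x) box touching near \<mu> C"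
        using G(3) by blast
      then interpret boxed_graph n "geometric_edges n (r n) x" box touching near \<mu> C .
      define a where "a = \<mu> / (50 * real C)"
      have C1: "1 \<le> real C" using C_ge by simp
      have KC: "K = 4 * real C * B" using C1 by (simp add: K_def)
      have a: "0 < a" "2 * a \<le> \<mu> / 4" using mu_ge C1 by (auto simp: a_def field_simps)
      have m5: "real m \<le> \<mu> / 5" using m(2) ev(3,5) \<mu>(1) by linarith
      have h3: "(1 + \<epsilon> / 4) * L \<le> y L * (y L * ln (y L / 3) - 2 * ln (K * L))"
        using ev(1) L0 by (simp add: field_simps)
      show "measure_pmf.prob (irrigation_pmf n (c n) (geometric_edges n (r n) x)) {E. \<not> graph_connected n E} \<le> err L"
        unfolding err_def
        using ev(2) m(1) ev(4)[unfolded KC] h3[unfolded KC]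
        by (intro order_trans[OF prob_disconnected_le[OF a mc m5]]
            connectivity_bound[OF n L0 C_ge \<mu> ev(3) m(1) _ _ _ \<epsilon> \<Delta>_def a_def]) linarith+
    qed
    then have "measure (irrigation_law TYPE('d) n (r n) (c n)) {E. \<not> graph_connected n E} \<le> err L + 2 / real n"
      using G(2) by linarith
    moreover have "measure (irrigation_law TYPE('d) n (r n) (c n)) {E. \<not> graph_connected n E} =
      1 - measure (irrigation_law TYPE('d) n (r n) (c n)) {E. graph_connected n E}"
    proof -
      let ?Q = "irrigation_law TYPE('d) n (r n) (c n)"
      interpret Q: prob_space ?Q by (rule prob_space_irrigation_law)
      have "space ?Q = UNIV" using sets_irrigation_law[of n "r n" "c n", where 'd = 'd] sets.sets_into_space
        by (metis UNIV_I top.extremum_uniqueI)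
      moreover have "{E. \<not> graph_connected n E} = UNIV - {E. graph_connected n E}" by auto
      ultimately show ?thesis using Q.prob_compl[of "{E. graph_connected n E}"] by (simp add: sets_irrigation_law)
    qed
    ultimately show ?case by (simp add: L_def)
  qed
  have "((\<lambda>n. err (ln (real n))) \<longlongrightarrow> 0) sequentially"
    using filterlim_compose[OF connectivity_error_tendsto[OF \<epsilon>] lnlim] by (simp add: err_def)
  moreover have "((\<lambda>n. 2 / real n) \<longlongrightarrow> 0) sequentially" by real_asymp
  ultimately have "(\<lambda>n. 1 - (err (ln (real n)) + 2 / real n)) \<longlonglongrightarrow> 1 - (0 + 0)"
    by (intro tendsto_diff tendsto_add tendsto_const)
  then have lim: "(\<lambda>n. 1 - (err (ln (real n)) + 2 / real n)) \<longlonglongrightarrow> 1" by simp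
  show ?thesis
    by (rule tendsto_sandwich[OF bound _ lim tendsto_const])
      (simp add: prob_space.prob_le_1[OF prob_space_irrigation_law])
qed

lemma connected_prob_tendsto_0:
  fixes \<gamma> \<epsilon> :: real and c :: "nat \<Rightarrow> nat"
  assumes \<gamma>: "24 * real CARD('d::finite) \<le> \<gamma>" and \<epsilon>: "0 < \<epsilon>" "\<epsilon> < 2"
    and c: "\<forall>\<^sub>F n in sequentially. real (c n) \<le> sqrt ((2 - \<epsilon>) * ln (real n) / ln (ln (real n)))"
    and c1: "\<forall>\<^sub>F n in sequentially. 1 \<le> c n"
  defines "r \<equiv> \<lambda>n. \<gamma> * (ln (real n) / real n) powr (1 / real CARD('d))"
  shows "(\<lambda>n. measure (irrigation_law TYPE('d) n (r n) (c n)) {E. graph_connected n E}) \<longlonglongrightarrow> 0"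
proof -
  obtain B C and near :: "('d \<Rightarrow> int) \<Rightarrow> ('d \<Rightarrow> int) set" where B: "0 < B"
    and boxed: "\<forall>\<^sub>F n in sequentially.
    \<exists>\<mu>. 8 * ln (real n) \<le> \<mu> \<and> \<mu> \<le> B * ln (real n) \<and>
      (\<exists>G \<in> sets (uniform_points n :: (nat \<Rightarrow> real ^ 'd) measure). 1 - 2 / real n \<le> measure (uniform_points n) G \<and>
         (\<forall>x\<in>G. \<exists>box. boxed_graph n (geometric_edges n (r n) x) box touching near \<mu> C))"
    using geometric_graph_boxed[OF \<gamma>] unfolding r_def by blast
  define K where "K = 4 * max 1 (real C) * B"
  define \<beta> where "\<beta> = sqrt (2 - \<epsilon>)"
  define y where "y x = \<beta> * sqrt (x / ln x)" for x :: real
  have \<beta>: "0 < \<beta>" "\<beta>\<^sup>2 = 2 - \<epsilon>" using \<epsilon> by (auto simp: \<beta>_def)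
  have K: "0 < K" using B by (simp add: K_def)
  have lnlim: "filterlim (\<lambda>n. ln (real n)) at_top sequentially" by real_asymp
  let ?e = "\<lambda>x. x - 2 * ln (K * x) - (y x + 1) * y x * ln (exp 1 * (K * x) / y x) - 80 * real C * (y x * (y x + 1))"
  have lead: "\<forall>\<^sub>F x in at_top. \<epsilon> / 4 < ?e x / x"
  proof -
    have "\<epsilon> / 4 < 1 - \<beta>\<^sup>2 / 2" using \<epsilon> unfolding \<beta>(2) by (simp add: field_simps)
    then show ?thesis
      unfolding y_def by (rule order_tendstoD(1)[OF scale_asymptotics(2)[OF \<beta>(1) K]])
  qed
  have ev: "\<forall>\<^sub>F x in at_top. \<epsilon> / 4 < ?e x / x \<and> y x \<le> K * x \<and> 3 * y x + 3 \<le> 8 * x / 10 \<and> 3 \<le> x"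
    using lead scale_asymptotics(5,6)[OF \<beta>(1) K] eventually_ge_at_top[of "3 :: real"]
    unfolding y_def by (intro eventually_conj)
  have bound: "\<forall>\<^sub>F n in sequentially.
     measure (irrigation_law TYPE('d) n (r n) (c n)) {E. graph_connected n E} \<le> exp (- exp (\<epsilon> / 4 * ln (real n))) + 2 / real n"
    using boxed c c1 eventually_compose_filterlim[OF ev lnlim] eventually_gt_at_top[of 0]
  proof eventually_elim
    case (elim n)
    define L where "L = ln (real n)"
    have n: "real n = exp L" using elim(5) by (simp add: L_def)
    obtain \<mu> G where \<mu>: "8 * L \<le> \<mu>" "\<mu> \<le> B * L"
      and G: "G \<in> sets (uniform_points n :: (nat \<Rightarrow> real ^ 'd) measure)" "1 - 2 / real n \<le> measure (uniform_points n) G"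
        "\<forall>x\<in>G. \<exists>box. boxed_graph n (geometric_edges n (r n) x) box touching near \<mu> C"
      using elim(1) unfolding L_def by blast
    have ev: "\<epsilon> / 4 < ?e L / L" "y L \<le> K * L" "3 * y L + 3 \<le> 8 * L / 10" "3 \<le> L"
      using elim(4) unfolding L_def by blast+
    have L0: "0 < L" using ev(4) by linarith
    have "y L = sqrt ((2 - \<epsilon>) * ln (real n) / ln (ln (real n)))"
      by (simp add: y_def \<beta>_def L_def real_sqrt_mult[symmetric] del: real_sqrt_mult)
    then have cy: "real (c n) \<le> y L" using elim(2) by simp
    have "measure (irrigation_law TYPE('d) n (r n) (c n)) {E. graph_connected n E}
       \<le> exp (- exp (\<epsilon> / 4 * L)) + (1 - measure (uniform_points n) G)"
    proof (rule irrigation_law_le[OF G(1)])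
      fix x assume "x \<in> G"
      then obtain box where "boxed_graph n (geometric_edges n (r n) x) box touching near \<mu> C"
        using G(3) by blast
      then interpret boxed_graph n "geometric_edges n (r n) x" box touching near \<mu> C .
      have C1: "1 \<le> real C" using C_ge by simp
      have "4 * real C * \<mu> \<le> 4 * real C * (B * L)" using \<mu>(2) by (intro mult_left_mono) auto
      then have \<Delta>K: "\<Delta> \<le> K * L" using C1 by (simp add: \<Delta>_def K_def mult.assoc)
      have c: "0 < c n" "3 * real (c n) + 2 \<le> \<mu> / 10" using elim(3) cy ev(3) \<mu>(1) by linarith+
      have h: "\<epsilon> / 4 * L \<le> ?e L" using ev(1) L0 by (simp add: less_divide_eq)
      note prob_connected_le[OF c]
      also note isolation_bound[OF n elim(3) cy ev(2) Delta_ge \<Delta>K h]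
      finally show "measure_pmf.prob (irrigation_pmf n (c n) (geometric_edges n (r n) x)) {E. graph_connected n E}
        \<le> exp (- exp (\<epsilon> / 4 * L))" .
    qed simp
    then show ?case using G(2) unfolding L_def by linarith
  qed
  have "((\<lambda>n. exp (- exp (\<epsilon> / 4 * ln (real n)))) \<longlongrightarrow> 0) sequentially"
    by (rule filterlim_compose[OF isolation_error_tendsto[OF \<epsilon>(1)] lnlim])
  moreover have "((\<lambda>n. 2 / real n) \<longlongrightarrow> 0) sequentially" by real_asymp
  ultimately have lim: "(\<lambda>n. exp (- exp (\<epsilon> / 4 * ln (real n))) + 2 / real n) \<longlonglongrightarrow> 0"
    by (rule tendsto_add_zero)
  show ?thesis
    by (rule tendsto_sandwich[OF _ bound tendsto_const lim]) simp
qed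

theorem theorem1:
  shows "\<exists>\<gamma>0 :: real. \<forall>\<gamma> \<ge> \<gamma>0. \<forall>\<epsilon> :: real. 0 < \<epsilon> \<and> \<epsilon> < 2 \<longrightarrow>
    (\<forall>c :: nat \<Rightarrow> nat. (\<forall>n \<ge> 3. 2 \<le> c n \<and> c n < n) \<longrightarrow>
      (let r = (\<lambda>n. \<gamma> * (ln (real n) / real n) powr (1 / real CARD('d::finite)));
           p = (\<lambda>n. measure (irrigation_law TYPE('d) n (r n) (c n)) {E. graph_connected n E})
       in ((\<forall>\<^sub>F n in sequentially.
              real (c n) \<ge> sqrt ((2 + \<epsilon>) * ln (real n) / ln (ln (real n)))) \<longrightarrow> p \<longlonglongrightarrow> 1) \<and>
          ((\<forall>\<^sub>F n in sequentially.
              real (c n) \<le> sqrt ((2 - \<epsilon>) * ln (real n) / ln (ln (real n)))) \<longrightarrow> p \<longlonglongrightarrow> 0)))"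
proof (intro exI[of _ "24 * real CARD('d)"] allI impI)
  fix \<gamma> \<epsilon> :: real and c :: "nat \<Rightarrow> nat"
  assume \<gamma>: "24 * real CARD('d) \<le> \<gamma>" and \<epsilon>: "0 < \<epsilon> \<and> \<epsilon> < 2" and c: "\<forall>n \<ge> 3. 2 \<le> c n \<and> c n < n"
  have c1: "\<forall>\<^sub>F n in sequentially. 1 \<le> c n"
    using eventually_ge_at_top[of 3] by eventually_elim (use c in fastforce)
  show "let r = (\<lambda>n. \<gamma> * (ln (real n) / real n) powr (1 / real CARD('d)));
           p = (\<lambda>n. measure (irrigation_law TYPE('d) n (r n) (c n)) {E. graph_connected n E})
       in ((\<forall>\<^sub>F n in sequentially.
              real (c n) \<ge> sqrt ((2 + \<epsilon>) * ln (real n) / ln (ln (real n)))) \<longrightarrow> p \<longlonglongrightarrow> 1) \<and>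
          ((\<forall>\<^sub>F n in sequentially.
              real (c n) \<le> sqrt ((2 - \<epsilon>) * ln (real n) / ln (ln (real n)))) \<longrightarrow> p \<longlonglongrightarrow> 0)"
    unfolding Let_def
    using connected_prob_tendsto_1[OF \<gamma>, of \<epsilon> c] connected_prob_tendsto_0[OF \<gamma>, of \<epsilon> c] \<epsilon> c1 by blast
qed

end
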